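(* Let $(\Omega,d,\mu)$ be a connected metric space equipped with a separable, non-atomic Borel probability measure $\mu$, such that for every $f\in Lip(\Omega)$ and every $c\in\mathbb{R}$ one has $|\nabla f(x)|=0$ for $\mu$-a.e. $x$ in $\{f=c\}$, and suppose $(\Omega,d,\mu)$ admits a convex isoperimetric estimator $I$. Let $Y$ be a quasi-Banach rearrangement-invariant (q.r.i.) space on $(0,1)$ and let $X$ be a rearrangement-invariant (r.i.) space on $\Omega$. Assume that there is a constant $C>0$ such that $$\|Q_If\|_Y\le C\|f\|_{\bar X}\quad\text{for all } f\in\bar X.$$ Then there is a constant $C'>0$ such that for all $g\in Lip(\Omega)$ $$\inf_{c\in\mathbb{R}}\|(g-c)_\mu^*\|_Y\le C'\,\big\||\nabla g|\big\|_X.$$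
   Context: $Lip(\Omega)$ is the set of real-valued Lipschitz functions on $\Omega$, and $|\nabla f(x)|=\limsup_{d(x,y)\to0}\frac{|f(x)-f(y)|}{d(x,y)}$. The Minkowski content of a Borel set $A$ is $\mu^+(A)=\liminf_{h\to0^+}\frac{\mu(A_h)-\mu(A)}{h}$, $A_h=\{x:d(x,A)<h\}$. $(\Omega,d,\mu)$ admits the convex isoperimetric estimator $I$ if $I:[0,1]\to[0,\infty)$ is continuous, convex on $[0,1/2]$, increasing on $(0,1/2)$, symmetric about $1/2$, $I(0)=0$, $I(t)>0$ on $(0,1)$, and $\mu^+(A)\ge I(\mu(A))$ for all Borel sets $A\subset\Omega$. The decreasing rearrangement is $u_\mu^*(s)=\inf\{t\ge0:\mu\{|u|>t\}\le s\}$, $0<s<1$. An r.i. space is a Banach function space $X$ such that if $f\in X$ and $g$ is measurable with $g^*_\mu=f^*_\mu$, then $g\in X$ and $\|g\|_X=\|f\|_X$; a q.r.i. space is defined in the same way with the triangle inequality weakened to $\|x+y\|\le C(\|x\|+\|y\|)$ (complete quasi-normed). For an r.i. space $X$ on $\Omega$, $\bar X$ denotes its representation space, the r.i. space on $(0,1)$ (Lebesgue measure) with $\|f\|_X=\|f_\mu^*\|_{\bar X}$ for all $f\in X$. The isoperimetric Hardy operator is $Q_If(t)=\int_t^{1/2}f(s)\frac{ds}{I(s)}$ for $0<t<1/2$, regarded as a function on $(0,1)$ by setting it equal to $0$ on $[1/2,1)$. *)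

theory Defs
  imports "HOL-Probability.Probability"
begin

section \<open>Metric measure spaces\<close>

definition Lip :: "('a::metric_space \<Rightarrow> real) set" where
  "Lip = {f. \<exists>L. L-lipschitz_on UNIV f}"

text \<open>The upper limit is taken over \<open>y \<noteq> x\<close> and formed in the extended reals, so that it always
  exists; it is finite for Lipschitz functions.\<close>

definition grad_modulus :: "('a::metric_space \<Rightarrow> real) \<Rightarrow> 'a \<Rightarrow> real" where
  "grad_modulus f x = real_of_ereal (Limsup (at x) (\<lambda>y. ereal (\<bar>f x - f y\<bar> / dist x y)))"

text \<open>For \<open>A \<noteq> {}\<close> this is \<open>{x. infdist x A < h}\<close>; it differs for \<open>A = {}\<close>, where the library
  puts \<open>infdist x {} = 0\<close> while the usual convention is distance infinity.\<close>

definition enlargement :: "real \<Rightarrow> 'a::metric_space set \<Rightarrow> 'a set" where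
  "enlargement h A = {x. \<exists>a\<in>A. dist x a < h}"

definition minkowski_content :: "'a::metric_space measure \<Rightarrow> 'a set \<Rightarrow> ereal" where
  "minkowski_content M A =
     Liminf (at_right 0) (\<lambda>h. ereal ((measure M (enlargement h A) - measure M A) / h))"

definition convex_isoperimetric_estimator ::
    "'a::metric_space measure \<Rightarrow> (real \<Rightarrow> real) \<Rightarrow> bool" where
  "convex_isoperimetric_estimator M I \<longleftrightarrow>
     (\<forall>t\<in>{0..1}. 0 \<le> I t) \<and>
     continuous_on {0..1} I \<and>
     convex_on {0..1/2} I \<and>
     mono_on {0<..<1/2} I \<and>
     (\<forall>t\<in>{0..1}. I (1 - t) = I t) \<and>
     I 0 = 0 \<and>
     (\<forall>t\<in>{0<..<1}. 0 < I t) \<and>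
     (\<forall>A\<in>sets borel. ereal (I (measure M A)) \<le> minkowski_content M A)"

text \<open>Separability of the measure algebra under the pseudometric \<open>\<mu>(A \<triangle> B)\<close>.\<close>

definition separable_measure :: "'a measure \<Rightarrow> bool" where
  "separable_measure M \<longleftrightarrow>
     (\<exists>D. countable D \<and> D \<subseteq> sets M \<and>
          (\<forall>A\<in>sets M. \<forall>e>0. \<exists>B\<in>D. emeasure M ((A - B) \<union> (B - A)) < ennreal e))"

definition non_atomic :: "'a measure \<Rightarrow> bool" where
  "non_atomic M \<longleftrightarrow>
     \<not> (\<exists>A\<in>sets M. emeasure M A > 0 \<and>
          (\<forall>B\<in>sets M. B \<subseteq> A \<longrightarrow> emeasure M B = 0 \<or> emeasure M (A - B) = 0))"

section \<open>Rearrangement-invariant spaces\<close>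

text \<open>Meaningful for \<open>0 < s < 1\<close> and a finite measure.\<close>

definition decr_rearr :: "'a measure \<Rightarrow> ('a \<Rightarrow> real) \<Rightarrow> real \<Rightarrow> real" where
  "decr_rearr M u s = Inf {t. 0 \<le> t \<and> measure M {x \<in> space M. t < \<bar>u x\<bar>} \<le> s}"

text \<open>A function space over \<open>M\<close> is given by its norm \<open>N\<close>, extended by the value infinity to the
  measurable functions outside the space. Functions in such a space are finite almost
  everywhere, so real-valued representatives suffice. The values of \<open>N\<close> at non-measurable
  functions are irrelevant.\<close>

definition in_space :: "'a measure \<Rightarrow> (('a \<Rightarrow> real) \<Rightarrow> ennreal) \<Rightarrow> ('a \<Rightarrow> real) set" where
  "in_space M N = {f \<in> borel_measurable M. N f < \<infinity>}"

text \<open>\<open>K\<close> is the constant of the quasi-triangle inequality; \<open>K = 1\<close> gives a norm.\<close>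

definition function_quasinorm :: "'a measure \<Rightarrow> real \<Rightarrow> (('a \<Rightarrow> real) \<Rightarrow> ennreal) \<Rightarrow> bool" where
  "function_quasinorm M K N \<longleftrightarrow>
     (\<forall>f\<in>borel_measurable M. N f = 0 \<longleftrightarrow> (AE x in M. f x = 0)) \<and>
     (\<forall>f\<in>borel_measurable M. \<forall>a. N (\<lambda>x. a * f x) = ennreal \<bar>a\<bar> * N f) \<and>
     (\<forall>f\<in>borel_measurable M. \<forall>g\<in>borel_measurable M.
        N (\<lambda>x. f x + g x) \<le> ennreal K * (N f + N g)) \<and>
     (\<forall>f\<in>borel_measurable M. \<forall>g\<in>borel_measurable M.
        (AE x in M. \<bar>f x\<bar> \<le> \<bar>g x\<bar>) \<longrightarrow> N f \<le> N g) \<and>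
     (\<forall>E\<in>sets M. emeasure M E < \<infinity> \<longrightarrow> N (indicator E) < \<infinity>)"

text \<open>Banach function spaces in the sense of Bennett and Sharpley, i.e. with the Fatou property and
  local embedding into \<open>L\<^sup>1\<close>. Completeness is then automatic (Riesz--Fischer).\<close>

definition banach_function_space :: "'a measure \<Rightarrow> (('a \<Rightarrow> real) \<Rightarrow> ennreal) \<Rightarrow> bool" where
  "banach_function_space M N \<longleftrightarrow>
     function_quasinorm M 1 N \<and>
     (\<forall>F. \<forall>f\<in>borel_measurable M.
        (\<forall>n::nat. F n \<in> borel_measurable M) \<longrightarrow>
        (AE x in M. (\<forall>n. 0 \<le> F n x \<and> F n x \<le> F (Suc n) x) \<and> (\<lambda>n. F n x) \<longlonglongrightarrow> f x) \<longrightarrow>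
        (\<lambda>n. N (F n)) \<longlonglongrightarrow> N f) \<and>
     (\<forall>E\<in>sets M. emeasure M E < \<infinity> \<longrightarrow>
        (\<exists>C::real. \<forall>f\<in>borel_measurable M. (\<integral>\<^sup>+x\<in>E. ennreal \<bar>f x\<bar> \<partial>M) \<le> ennreal C * N f))"

text \<open>Neither the Fatou property nor the embedding into \<open>L\<^sup>1\<close> is imposed here; the latter would
  exclude \<open>L\<^sup>p\<close> for \<open>p < 1\<close>. Completeness therefore has to be required.\<close>

definition quasi_banach_function_space :: "'a measure \<Rightarrow> (('a \<Rightarrow> real) \<Rightarrow> ennreal) \<Rightarrow> bool" where
  "quasi_banach_function_space M N \<longleftrightarrow>
     (\<exists>K\<ge>1. function_quasinorm M K N) \<and>
     (\<forall>F. (\<forall>n::nat. F n \<in> in_space M N) \<longrightarrow>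
        (\<forall>e>0. \<exists>n0. \<forall>m\<ge>n0. \<forall>n\<ge>n0. N (\<lambda>x. F m x - F n x) < ennreal e) \<longrightarrow>
        (\<exists>f\<in>in_space M N. (\<lambda>n. N (\<lambda>x. F n x - f x)) \<longlonglongrightarrow> 0))"

definition rearr_invariant :: "'a measure \<Rightarrow> (('a \<Rightarrow> real) \<Rightarrow> ennreal) \<Rightarrow> bool" where
  "rearr_invariant M N \<longleftrightarrow>
     (\<forall>f\<in>in_space M N. \<forall>g\<in>borel_measurable M.
        (\<forall>s\<in>{0<..<1}. decr_rearr M g s = decr_rearr M f s) \<longrightarrow>
        g \<in> in_space M N \<and> N g = N f)"

definition ri_space :: "'a measure \<Rightarrow> (('a \<Rightarrow> real) \<Rightarrow> ennreal) \<Rightarrow> bool" where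
  "ri_space M N \<longleftrightarrow> banach_function_space M N \<and> rearr_invariant M N"

definition qri_space :: "'a measure \<Rightarrow> (('a \<Rightarrow> real) \<Rightarrow> ennreal) \<Rightarrow> bool" where
  "qri_space M N \<longleftrightarrow> quasi_banach_function_space M N \<and> rearr_invariant M N"

abbreviation unit_interval :: "real measure" where
  "unit_interval \<equiv> lebesgue_on {0<..<1}"

definition representation_space ::
    "'a measure \<Rightarrow> (('a \<Rightarrow> real) \<Rightarrow> ennreal) \<Rightarrow> ((real \<Rightarrow> real) \<Rightarrow> ennreal) \<Rightarrow> bool" where
  "representation_space M X Xbar \<longleftrightarrow>
     ri_space unit_interval Xbar \<and> (\<forall>f\<in>in_space M X. X f = Xbar (decr_rearr M f))"

text \<open>The integral converges absolutely for \<open>f\<close> in an r.i. space on \<open>(0,1)\<close>, since then \<open>f\<close> is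
  integrable and \<open>1 / I\<close> is bounded on \<open>{t..1/2}\<close>.\<close>

definition isoperimetric_hardy :: "(real \<Rightarrow> real) \<Rightarrow> (real \<Rightarrow> real) \<Rightarrow> real \<Rightarrow> real" where
  "isoperimetric_hardy I f t =
     (if 0 < t \<and> t < 1/2 then (LINT s:{t..1/2}|lebesgue. f s / I s) else 0)"

end

theory Submission imports Defs begin

text \<open>
  Let \<open>m\<close> be a median of the Lipschitz function \<open>g\<close>. Both \<open>u = (g - m)\<^sup>+\<close> and \<open>v = (g - m)\<^sup>-\<close>
  live on sets of measure at most one half, so \<open>|g - m|\<close> has the distribution of the function that
  equals the rearrangement of \<open>u\<close> on the left half of the unit interval and the reflected
  rearrangement of \<open>v\<close> on the right half. By the quasi-triangle inequality \<open>u\<close> and \<open>v\<close> can be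
  treated separately. For \<open>u\<close> (likewise \<open>v\<close>) it suffices to find a function \<open>\<phi>\<close> on the unit interval such that
  \<^item> the decreasing rearrangement \<open>u\<^sup>*\<close> satisfies \<open>u\<^sup>* \<le> 2 * Q \<phi>\<close>, where \<open>Q\<close> is the
    isoperimetric Hardy operator, and
  \<^item> \<open>\<phi>\<close> has the same distribution as \<open>|\<nabla>u|\<close> multiplied by the indicator of a set.

  The second property gives \<open>Xbar \<phi> \<le> X |\<nabla>u|\<close> by rearrangement invariance, so the assumed
  bound for \<open>Q\<close> finishes the argument.

  The link between \<open>u\<^sup>*\<close> and the gradient is the coarea inequality
  \<open>\<integral> I (\<mu> {w > s}) ds \<le> \<integral> |\<nabla>w| d\<mu>\<close> for Lipschitz \<open>w\<close> (\<open>coarea_inequality\<close>), which follows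
  from the isoperimetric inequality for the superlevel sets of \<open>w\<close> and Fatou's lemma. Applied to the
  truncations of \<open>u\<close>, it yields for \<open>0 < t \<le> t' \<le> 1/2\<close> that \<open>I t * (u\<^sup>* t - u\<^sup>* t')\<close> is at most
  the integral of \<open>|\<nabla>u|\<close> over \<open>{u\<^sup>* t' < u < u\<^sup>* t}\<close>, a set of measure at most \<open>t' - t\<close>.

  To choose \<open>\<phi>\<close>, cut \<open>(0, 1/2)\<close> into countably many blocks at the points \<open>T j\<close> where
  \<open>I (T j) = I (1/2) / 2 ^ j\<close>, so that \<open>I\<close> varies by at most a factor two on each block. To the block
  between \<open>T (Suc j)\<close> and \<open>T j\<close> corresponds the set \<open>A j\<close> on which \<open>u\<close> lies strictly between
  \<open>u\<^sup>* (T j)\<close> and \<open>u\<^sup>* (T (Suc j))\<close>; its measure is at most the length of the block. Let \<open>\<phi>\<close>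
  be, on that block, the increasing rearrangement of \<open>|\<nabla>u|\<close> restricted to \<open>A j\<close>. Then \<open>\<phi>\<close> has the
  distribution of \<open>|\<nabla>u|\<close> on the union of the disjoint sets \<open>A j\<close>. Moreover the mass of \<open>\<phi>\<close> between
  \<open>t\<close> and the right end \<open>T j\<close> of its block is at least the integral of \<open>|\<nabla>u|\<close> over any subset of
  \<open>A j\<close> of measure at most \<open>T j - t\<close>, in particular over the set that controls
  \<open>u\<^sup>* t - u\<^sup>* (T j)\<close>. Since \<open>I\<close> is comparable to \<open>I t\<close> between \<open>t\<close> and \<open>T j\<close>, this increment is
  at most \<open>2 * \<integral> \<phi> / I\<close> over that range, and summing over the blocks to the right of \<open>t\<close> gives
  \<open>u\<^sup>* \<le> 2 * Q \<phi>\<close> (\<open>decr_rearr_le_isoperimetric_hardy\<close>).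
\<close>

section \<open>The pointwise gradient modulus\<close>

lemma LipE:
  assumes "g \<in> Lip"
  obtains L where "L > 0" "\<And>x y. \<bar>g x - g y\<bar> \<le> L * dist x y"
proof -
  from assms obtain L where L: "L-lipschitz_on UNIV g" by (auto simp: Lip_def)
  have "\<bar>g x - g y\<bar> \<le> (L + 1) * dist x y" for x y
  proof -
    have "\<bar>g x - g y\<bar> \<le> L * dist x y"
      using lipschitz_onD[OF L, of x y] by (simp add: dist_real_def)
    also have "\<dots> \<le> (L + 1) * dist x y" by (simp add: mult_right_mono)
    finally show ?thesis .
  qed
  moreover have "L + 1 > 0" using lipschitz_on_nonneg[OF L] by simp
  ultimately show thesis using that by blast
qed

lemma LipI:
  assumes "\<And>x y. \<bar>g x - g y\<bar> \<le> L * dist x y"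
  shows "g \<in> Lip"
proof -
  have "\<bar>g x - g y\<bar> \<le> max L 0 * dist x y" for x y
    by (rule order_trans[OF assms]) (simp add: mult_right_mono)
  then have "(max L 0)-lipschitz_on UNIV g"
    by (intro lipschitz_onI) (auto simp: dist_real_def)
  then show ?thesis by (auto simp: Lip_def)
qed

lemma Lip_contraction:
  assumes "g \<in> Lip" "\<And>x y. \<bar>f x - f y\<bar> \<le> \<bar>g x - g y\<bar>"
  shows "f \<in> Lip"
proof -
  obtain L where "L > 0" "\<And>x y. \<bar>g x - g y\<bar> \<le> L * dist x y" by (rule LipE[OF assms(1)]) (rule that)
  then show ?thesis using assms(2) by (intro LipI[of f L]) (meson order_trans)
qed

lemma Lip_continuous: "g \<in> Lip \<Longrightarrow> continuous_on UNIV g"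
  by (auto simp: Lip_def intro: lipschitz_on_continuous_on)

text \<open>At an isolated point the upper limit is \<open>-\<infinity>\<close>, which the conversion to a real number sends
  to zero.\<close>

lemma grad_modulus_nonneg:
  fixes f :: "'a::metric_space \<Rightarrow> real"
  shows "0 \<le> grad_modulus f x"
proof (cases "at x = (bot :: 'a filter)")
  case True
  then show ?thesis by (simp add: grad_modulus_def bot_ereal_def)
next
  case False
  have "0 \<le> Limsup (at x) (\<lambda>y. ereal (\<bar>f x - f y\<bar> / dist x y))"
    by (rule le_Limsup[OF False]) (auto intro!: always_eventually)
  then show ?thesis by (simp add: grad_modulus_def real_of_ereal_pos)
qed

lemma Lip_Limsup_le:
  fixes f :: "'a::metric_space \<Rightarrow> real"
  assumes "\<And>y. \<bar>f x - f y\<bar> \<le> L * dist x y"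
  shows "Limsup (at x) (\<lambda>y. ereal (\<bar>f x - f y\<bar> / dist x y)) \<le> ereal L"
proof (rule Limsup_bounded)
  show "\<forall>\<^sub>F y in at x. ereal (\<bar>f x - f y\<bar> / dist x y) \<le> ereal L"
    unfolding eventually_at
  proof (rule exI[of _ 1], intro conjI ballI impI)
    fix y assume "y \<noteq> x \<and> dist y x < 1"
    then have "dist x y > 0" by auto
    then show "ereal (\<bar>f x - f y\<bar> / dist x y) \<le> ereal L"
      using assms[of y] by (simp add: divide_le_eq)
  qed simp
qed

lemma grad_modulus_le:
  assumes "\<And>y. \<bar>f x - f y\<bar> \<le> L * dist x y" "0 \<le> L"
  shows "grad_modulus f x \<le> L"
proof -
  let ?S = "Limsup (at x) (\<lambda>y. ereal (\<bar>f x - f y\<bar> / dist x y))"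
  have "?S \<le> ereal L" by (rule Lip_Limsup_le[OF assms(1)])
  then show ?thesis using assms(2) by (cases ?S) (auto simp: grad_modulus_def)
qed

lemma grad_modulus_contraction:
  fixes f g :: "'a::metric_space \<Rightarrow> real"
  assumes "g \<in> Lip" "\<And>x y. \<bar>f x - f y\<bar> \<le> \<bar>g x - g y\<bar>"
  shows "grad_modulus f x \<le> grad_modulus g x"
proof (cases "at x = (bot :: 'a filter)")
  case True
  then show ?thesis by (simp add: grad_modulus_def)
next
  case False
  let ?S = "\<lambda>f. Limsup (at x) (\<lambda>y. ereal (\<bar>f x - f y\<bar> / dist x y))"
  obtain L where "L > 0" and L: "\<And>x y. \<bar>g x - g y\<bar> \<le> L * dist x y" by (rule LipE[OF assms(1)]) (rule that)
  have "?S f \<le> ?S g"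
    by (rule Limsup_mono) (auto intro!: always_eventually divide_right_mono assms(2))
  moreover have "?S g \<le> ereal L" by (rule Lip_Limsup_le[OF L])
  moreover have "0 \<le> ?S f"
    by (rule le_Limsup[OF False]) (auto intro!: always_eventually)
  ultimately show ?thesis
    unfolding grad_modulus_def
    by (intro real_of_ereal_positive_mono) auto
qed

lemma grad_modulus_lessD:
  fixes f :: "'a::metric_space \<Rightarrow> real"
  assumes f: "f \<in> Lip" and K: "grad_modulus f x < K"
  obtains d where "d > 0" "\<And>y. dist x y < d \<Longrightarrow> \<bar>f x - f y\<bar> \<le> K * dist x y"
proof -
  let ?S = "Limsup (at x) (\<lambda>y. ereal (\<bar>f x - f y\<bar> / dist x y))"
  obtain L where "L > 0" and L: "\<And>x y. \<bar>f x - f y\<bar> \<le> L * dist x y" by (rule LipE[OF f]) (rule that)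
  have "?S \<le> ereal L" by (rule Lip_Limsup_le[OF L])
  then have "?S < ereal K" using K by (cases ?S) (auto simp: grad_modulus_def)
  from Limsup_lessD[OF this] obtain d where d: "d > 0"
    "\<And>y. y \<noteq> x \<Longrightarrow> dist y x < d \<Longrightarrow> \<bar>f x - f y\<bar> / dist x y < K"
    by (auto simp: eventually_at)
  have "\<bar>f x - f y\<bar> \<le> K * dist x y" if "dist x y < d" for y
  proof (cases "y = x")
    case False
    then show ?thesis
      using d(2)[of y] that by (simp add: dist_commute divide_less_eq)
  qed simp
  with d(1) show thesis using that by blast
qed

text \<open>For a continuous function and a fixed radius, the supremum of the difference quotients over
  the punctured ball is lower semicontinuous in the centre, because each quotient is continuous and
  the condition \<open>0 < dist x y < r\<close> is open in \<open>x\<close>. The modulus is a countable infimum of such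
  functions.\<close>

lemma borel_measurable_grad_modulus:
  fixes f :: "'a::metric_space \<Rightarrow> real"
  assumes f: "f \<in> Lip"
  shows "grad_modulus f \<in> borel_measurable borel"
proof -
  define q where "q x y = ereal (\<bar>f x - f y\<bar> / dist x y)" for x y
  define G where "G r x = (SUP y\<in>ball x r - {x}. q x y)" for r x
  have G_meas: "G r \<in> borel_measurable borel" for r
  proof (rule borel_measurableI_greater)
    fix c :: ereal
    have "open {x. c < G r x}"
    proof -
      have "{x. c < G r x} = (\<Union>y. {x. x \<in> ball y r - {y} \<and> c < q x y})"
        by (auto simp: G_def less_SUP_iff dist_commute)
      moreover have "open {x. x \<in> ball y r - {y} \<and> c < q x y}" for y
      proof -
        have "continuous_on (ball y r - {y}) (\<lambda>x. q x y)"
          unfolding q_def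
          by (intro continuous_intros continuous_on_subset[OF Lip_continuous[OF f]]) auto
        then have "open ((ball y r - {y}) \<inter> (\<lambda>x. q x y) -` {c<..})"
          by (intro continuous_open_preimage) auto
        moreover have "(ball y r - {y}) \<inter> (\<lambda>x. q x y) -` {c<..}
            = {x. x \<in> ball y r - {y} \<and> c < q x y}"
          by auto
        ultimately show ?thesis by simp
      qed
      ultimately show ?thesis by auto
    qed
    then show "{x \<in> space borel. c < G r x} \<in> sets borel" by simp
  qed
  have "Limsup (at x) (q x) = (INF n::nat. G (inverse (Suc n)) x)" for x
  proof -
    have "Limsup (at x) (q x) = (INF r\<in>{0<..}. G r x)"
      by (simp add: Limsup_at G_def)
    also have "\<dots> = (INF n::nat. G (inverse (Suc n)) x)"
    proof (rule antisym)
      show "(INF r\<in>{0<..}. G r x) \<le> (INF n::nat. G (inverse (Suc n)) x)"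
        by (intro INF_greatest INF_lower) (simp del: of_nat_Suc)
      show "(INF n::nat. G (inverse (Suc n)) x) \<le> (INF r\<in>{0<..}. G r x)"
      proof (rule INF_greatest)
        fix r :: real assume "r \<in> {0<..}"
        then obtain n where "inverse (real (Suc n)) < r" using reals_Archimedean by auto
        then have "G (inverse (Suc n)) x \<le> G r x"
          unfolding G_def by (intro SUP_subset_mono) auto
        then show "(INF n::nat. G (inverse (Suc n)) x) \<le> G r x"
          by (rule INF_lower2[OF UNIV_I])
      qed
    qed
    finally show ?thesis .
  qed
  then have "grad_modulus f = (\<lambda>x. real_of_ereal (INF n::nat. G (inverse (Suc n)) x))"
    by (auto simp: grad_modulus_def q_def [abs_def] simp del: of_nat_Suc)
  then show ?thesis using G_meas by simp
qed

section \<open>Layer-cake formula and coarea inequality\<close>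

text \<open>Fubini's theorem for the region between two graphs. A lower function other than zero
  is there for differences of functions that are not integrable, such as a Lipschitz function and its
  supremum over small balls.\<close>

lemma nn_integral_between_graphs:
  fixes f g :: "'a \<Rightarrow> real"
  assumes "sigma_finite_measure M"
    and [measurable]: "f \<in> borel_measurable M" "g \<in> borel_measurable M"
  shows "(\<integral>\<^sup>+x. ennreal (g x - f x) \<partial>M)
       = (\<integral>\<^sup>+l. emeasure M {x \<in> space M. f x \<le> l \<and> l < g x} \<partial>lborel)"
proof -
  interpret sigma_finite_measure M by fact
  interpret pair_sigma_finite M lborel ..
  let ?S = "{p \<in> space (M \<Otimes>\<^sub>M lborel). f (fst p) \<le> snd p \<and> snd p < g (fst p)}"
  have S: "?S \<in> sets (M \<Otimes>\<^sub>M lborel)" by measurable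
  have "(\<integral>\<^sup>+x. ennreal (g x - f x) \<partial>M) = (\<integral>\<^sup>+x. emeasure lborel (Pair x -` ?S) \<partial>M)"
  proof (rule nn_integral_cong)
    fix x assume "x \<in> space M"
    then have *: "Pair x -` ?S = {f x..<g x}" by (auto simp: space_pair_measure)
    show "ennreal (g x - f x) = emeasure lborel (Pair x -` ?S)"
      unfolding * by (cases "f x \<le> g x") (auto simp: ennreal_neg)
  qed
  also have "\<dots> = emeasure (M \<Otimes>\<^sub>M lborel) ?S"
    by (rule lborel.emeasure_pair_measure_alt[OF S, symmetric])
  also have "\<dots> = (\<integral>\<^sup>+l. emeasure M ((\<lambda>x. (x, l)) -` ?S) \<partial>lborel)"
    by (rule emeasure_pair_measure_alt2[OF S])
  also have "\<dots> = (\<integral>\<^sup>+l. emeasure M {x \<in> space M. f x \<le> l \<and> l < g x} \<partial>lborel)"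
    by (intro nn_integral_cong arg_cong[where f = "emeasure M"]) (auto simp: space_pair_measure)
  finally show ?thesis .
qed

lemma open_enlargement: "open (enlargement h A)"
proof -
  have "enlargement h A = (\<Union>a\<in>A. ball a h)" by (auto simp: enlargement_def dist_commute)
  then show ?thesis by auto
qed

text \<open>Integrating the Minkowski contents of the superlevel sets of \<open>w\<close>. With
  \<open>W h x\<close> the supremum of \<open>w\<close> over the ball of radius \<open>h\<close>, the \<open>h\<close>-enlargement of
  \<open>{s < w}\<close> is exactly \<open>{s < W h}\<close>, so the difference quotients
  \<open>(W h - w) / h\<close> integrate to those defining the contents. Fatou's lemma is then used on both
  sides: from below in \<open>s\<close>, and in reversed form in \<open>x\<close>, where the quotients are dominated by the
  Lipschitz constant and their upper limit is at most the gradient modulus.\<close>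

lemma coarea_inequality:
  fixes M :: "'a::metric_space measure" and w :: "'a \<Rightarrow> real" and J :: "real \<Rightarrow> real"
  assumes "prob_space M" and sets_M: "sets M = sets borel" and w: "w \<in> Lip"
    and J: "\<And>A. A \<in> sets borel \<Longrightarrow> ereal (J (measure M A)) \<le> minkowski_content M A"
  shows "(\<integral>\<^sup>+s. ennreal (J (measure M {x. s < w x})) \<partial>lborel)
       \<le> (\<integral>\<^sup>+x. ennreal (grad_modulus w x) \<partial>M)"
proof -
  interpret prob_space M by fact
  have space_M [simp]: "space M = UNIV" using sets_eq_imp_space_eq[OF sets_M] by simp
  note [measurable_cong] = sets_M
  obtain L where L: "L > 0" "\<And>x y. \<bar>w x - w y\<bar> \<le> L * dist x y" by (rule LipE[OF w]) (rule that)
  have w_meas [measurable]: "w \<in> borel_measurable borel"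
    using Lip_continuous[OF w] by (rule borel_measurable_continuous_onI)
  have [measurable]: "grad_modulus w \<in> borel_measurable borel"
    by (rule borel_measurable_grad_modulus[OF w])
  define h where "h n = inverse (real (Suc n))" for n
  have h: "h n > 0" "h n \<noteq> 0" for n by (auto simp: h_def)
  have h_lim: "filterlim h (at_right 0) sequentially"
    unfolding filterlim_at using LIMSEQ_inverse_real_of_nat h(1)
    by (auto simp: h_def [abs_def] simp del: of_nat_Suc)
  \<comment> \<open>Enlargements use open balls, and so does \<open>W\<close>, to have the level sets match exactly.\<close>
  define W where "W n x = (SUP y\<in>ball x (h n). w y)" for n x
  have bdd: "w y \<le> w x + K * h n" if "y \<in> ball x (h n)" "K \<ge> 0"
    "\<And>y. dist x y < h n \<Longrightarrow> \<bar>w x - w y\<bar> \<le> K * dist x y" for x y n K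
  proof -
    have "\<bar>w x - w y\<bar> \<le> K * dist x y" using that by simp
    also have "\<dots> \<le> K * h n" using that by (intro mult_left_mono) auto
    finally show ?thesis by linarith
  qed
  have bdd_above: "bdd_above (w ` ball x (h n))" for x n
    using bdd[of _ x n L] L by (intro bdd_aboveI2[where M = "w x + L * h n"]) auto
  have W_le: "W n x \<le> w x + K * h n" if "K \<ge> 0"
    "\<And>y. dist x y < h n \<Longrightarrow> \<bar>w x - w y\<bar> \<le> K * dist x y" for x n K
    unfolding W_def using h(1)[of n] bdd that by (intro cSUP_least) auto
  have W_ge: "w x \<le> W n x" for x n
    unfolding W_def using h(1)[of n] bdd_above by (intro cSUP_upper) auto
  have superlevel: "{x. s < W n x} = enlargement (h n) {x. s < w x}" for s n
  proof -
    have "s < W n x \<longleftrightarrow> (\<exists>y\<in>ball x (h n). s < w y)" for x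
      unfolding W_def using h(1)[of n] bdd_above by (intro less_cSUP_iff) auto
    then show ?thesis by (auto simp: enlargement_def dist_commute)
  qed
  have W_meas [measurable]: "W n \<in> borel_measurable borel" for n
    by (rule borel_measurableI_greater) (simp add: superlevel open_enlargement)
  define m where "m s = measure M {x. s < w x}" for s
  define q where "q n s = (measure M (enlargement (h n) {x. s < w x}) - m s) / h n" for n s
  have q_meas [measurable]: "q n \<in> borel_measurable lborel" for n
  proof -
    have "(\<lambda>s. - measure M {x. s < f x}) \<in> borel_measurable borel"
      if "f \<in> borel_measurable borel" for f :: "'a \<Rightarrow> real"
      using that by (intro borel_measurable_mono monoI) (auto intro!: finite_measure_mono)
    from this[OF W_meas[of n]] this[OF w_meas]
    have "(\<lambda>s. (- (- measure M {x. s < W n x}) + (- measure M {x. s < w x})) / h n)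
        \<in> borel_measurable borel"
      by measurable
    then show ?thesis by (simp add: q_def [abs_def] superlevel m_def)
  qed
  have quotient: "(\<integral>\<^sup>+x. ennreal ((W n x - w x) / h n) \<partial>M) = (\<integral>\<^sup>+s. ennreal (q n s) \<partial>lborel)" for n
  proof -
    have "emeasure M {x \<in> space M. w x \<le> s \<and> s < W n x} = ennreal (h n) * ennreal (q n s)" for s
    proof -
      have "{x \<in> space M. w x \<le> s \<and> s < W n x} = {x. s < W n x} - {x. s < w x}" by auto
      then have "measure M {x \<in> space M. w x \<le> s \<and> s < W n x}
          = measure M {x. s < W n x} - measure M {x. s < w x}"
        using W_ge by (simp, intro finite_measure_Diff) (auto intro: less_le_trans)
      also have "\<dots> = h n * q n s" using h[of n] by (simp add: q_def m_def superlevel)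
      finally show ?thesis
        using h[of n] by (simp add: emeasure_eq_measure ennreal_mult')
    qed
    then have "(\<integral>\<^sup>+x. ennreal (W n x - w x) \<partial>M) = (\<integral>\<^sup>+s. ennreal (h n) * ennreal (q n s) \<partial>lborel)"
      by (subst nn_integral_between_graphs) (auto intro: sigma_finite_measure_axioms)
    also have "\<dots> = ennreal (h n) * (\<integral>\<^sup>+s. ennreal (q n s) \<partial>lborel)"
      by (intro nn_integral_cmult) auto
    finally have *: "(\<integral>\<^sup>+x. ennreal (W n x - w x) \<partial>M)
        = ennreal (h n) * (\<integral>\<^sup>+s. ennreal (q n s) \<partial>lborel)" .
    have "(\<integral>\<^sup>+x. ennreal ((W n x - w x) / h n) \<partial>M)
        = (\<integral>\<^sup>+x. ennreal (1 / h n) * ennreal (W n x - w x) \<partial>M)"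
      using h(1)[of n] W_ge by (intro nn_integral_cong) (simp add: ennreal_mult''[symmetric])
    also have "\<dots> = ennreal (1 / h n) * (\<integral>\<^sup>+x. ennreal (W n x - w x) \<partial>M)"
      by (intro nn_integral_cmult) auto
    also have "\<dots> = ennreal (1 / h n * h n) * (\<integral>\<^sup>+s. ennreal (q n s) \<partial>lborel)"
      using h(1)[of n] by (simp only: * mult.assoc[symmetric] ennreal_mult'')
    finally show ?thesis using h(2)[of n] by simp
  qed
  have "(\<integral>\<^sup>+s. ennreal (J (m s)) \<partial>lborel) \<le> (\<integral>\<^sup>+s. liminf (\<lambda>n. ennreal (q n s)) \<partial>lborel)"
  proof (rule nn_integral_mono)
    fix s
    have content: "ereal (J (m s)) \<le> Liminf (at_right 0)
        (\<lambda>r. ereal ((measure M (enlargement r {x. s < w x}) - m s) / r))"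
      unfolding m_def minkowski_content_def[symmetric] by (rule J) simp
    show "ennreal (J (m s)) \<le> liminf (\<lambda>n. ennreal (q n s))"
      unfolding le_Liminf_iff
    proof (intro allI impI)
      fix c assume c: "c < ennreal (J (m s))"
      then obtain r where r: "c = ennreal r" "0 \<le> r" by (cases c) auto
      then have "r < J (m s)" using c by (simp add: ennreal_less_iff)
      then have "\<forall>\<^sub>F d in at_right 0. ereal r
          < ereal ((measure M (enlargement d {x. s < w x}) - m s) / d)"
        using content[unfolded le_Liminf_iff, THEN spec, of "ereal r"] by simp
      from eventually_compose_filterlim[OF this h_lim]
      have "\<forall>\<^sub>F n in sequentially. r < q n s" by (simp add: q_def)
      then show "\<forall>\<^sub>F n in sequentially. c < ennreal (q n s)"
        by eventually_elim (use r in \<open>simp add: ennreal_less_iff\<close>)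
    qed
  qed
  also have "\<dots> \<le> liminf (\<lambda>n. \<integral>\<^sup>+s. ennreal (q n s) \<partial>lborel)"
    by (rule nn_integral_liminf) simp
  also have "\<dots> = liminf (\<lambda>n. \<integral>\<^sup>+x. ennreal ((W n x - w x) / h n) \<partial>M)"
    by (simp add: quotient)
  also have "\<dots> \<le> limsup (\<lambda>n. \<integral>\<^sup>+x. ennreal ((W n x - w x) / h n) \<partial>M)"
    by (rule Liminf_le_Limsup) simp
  also have "\<dots> \<le> (\<integral>\<^sup>+x. limsup (\<lambda>n. ennreal ((W n x - w x) / h n)) \<partial>M)"
  proof (rule nn_integral_limsup[where w = "\<lambda>_. ennreal L"])
    show "AE x in M. ennreal ((W n x - w x) / h n) \<le> ennreal L" for n
    proof (rule AE_I2)
      fix x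
      have "W n x \<le> w x + L * h n" by (rule W_le) (use L in auto)
      then show "ennreal ((W n x - w x) / h n) \<le> ennreal L"
        using h(1)[of n] by (intro ennreal_leI) (simp add: divide_le_eq)
    qed
  qed (auto simp: emeasure_space_1[unfolded space_M])
  also have "\<dots> \<le> (\<integral>\<^sup>+x. ennreal (grad_modulus w x) \<partial>M)"
  proof (rule nn_integral_mono)
    fix x
    show "limsup (\<lambda>n. ennreal ((W n x - w x) / h n)) \<le> ennreal (grad_modulus w x)"
      unfolding Limsup_le_iff
    proof (intro allI impI)
      fix c assume "ennreal (grad_modulus w x) < c"
      then obtain K where K: "ennreal (grad_modulus w x) < ennreal K" "ennreal K < c" "0 \<le> K"
        using dense[of "ennreal (grad_modulus w x)" c] by (metis ennreal_cases not_less top_greatest)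
      then have "grad_modulus w x < K"
        using grad_modulus_nonneg[of w x] by (simp add: ennreal_less_iff)
      then obtain d where d: "d > 0" "\<And>y. dist x y < d \<Longrightarrow> \<bar>w x - w y\<bar> \<le> K * dist x y"
        by (rule grad_modulus_lessD[OF w]) (rule that)
      have "\<forall>\<^sub>F n in sequentially. h n < d"
        using LIMSEQ_inverse_real_of_nat d(1) unfolding h_def by (rule order_tendstoD)
      then show "\<forall>\<^sub>F n in sequentially. ennreal ((W n x - w x) / h n) < c"
      proof eventually_elim
        fix n assume "h n < d"
        then have "W n x \<le> w x + K * h n" using K(3) d(2) by (intro W_le) auto
        then have "ennreal ((W n x - w x) / h n) \<le> ennreal K"
          using h(1)[of n] by (intro ennreal_leI) (simp add: divide_le_eq)
        then show "ennreal ((W n x - w x) / h n) < c" using K(2) by (rule le_less_trans)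
      qed
    qed
  qed
  finally show ?thesis by (simp add: m_def)
qed

text \<open>The function to which the coarea inequality is applied is the truncation of \<open>u\<close> to the
  values in \<open>{a..b}\<close>. Its gradient modulus vanishes almost everywhere on the two sets where the
  truncation is constant, by the hypothesis on level sets; this is what localises the right-hand
  side to \<open>{a < u < b}\<close>.\<close>

lemma coarea_between_levels:
  fixes M :: "'a::metric_space measure" and u :: "'a \<Rightarrow> real" and J :: "real \<Rightarrow> real"
  assumes "prob_space M" and sets_M: "sets M = sets borel" and u: "u \<in> Lip"
    and J: "\<And>A. A \<in> sets borel \<Longrightarrow> ereal (J (measure M A)) \<le> minkowski_content M A"
    and level: "\<And>f c. f \<in> Lip \<Longrightarrow> AE x in M. f x = c \<longrightarrow> grad_modulus f x = 0"
    and k: "0 \<le> k" "\<And>s. a \<le> s \<Longrightarrow> s < b \<Longrightarrow> k \<le> J (measure M {x. s < u x})"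
  shows "ennreal (k * (b - a)) \<le> (\<integral>\<^sup>+x\<in>{x. a < u x \<and> u x < b}. ennreal (grad_modulus u x) \<partial>M)"
proof (cases "a \<le> b")
  case False
  then have "k * (b - a) \<le> 0" using k(1) by (simp add: mult_nonneg_nonpos)
  then show ?thesis by (simp add: ennreal_neg)
next
  case True
  define w where "w x = max a (min b (u x))" for x
  have contr: "\<bar>w x - w y\<bar> \<le> \<bar>u x - u y\<bar>" for x y by (auto simp: w_def)
  then have w: "w \<in> Lip" by (rule Lip_contraction[OF u])
  have "ennreal (k * (b - a)) = (\<integral>\<^sup>+s\<in>{a..<b}. ennreal k \<partial>lborel)"
    using True k(1) by (simp add: nn_integral_cmult_indicator ennreal_mult)
  also have "\<dots> \<le> (\<integral>\<^sup>+s. ennreal (J (measure M {x. s < w x})) \<partial>lborel)"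
  proof (rule nn_integral_mono)
    fix s
    have "{x. s < w x} = {x. s < u x}" if "a \<le> s" "s < b" using that by (auto simp: w_def)
    then show "ennreal k * indicator {a..<b} s \<le> ennreal (J (measure M {x. s < w x}))"
      using k(2)[of s] by (auto simp: indicator_def intro: ennreal_leI)
  qed
  also have "\<dots> \<le> (\<integral>\<^sup>+x. ennreal (grad_modulus w x) \<partial>M)"
    by (rule coarea_inequality[OF assms(1) sets_M w J])
  also have "\<dots> \<le> (\<integral>\<^sup>+x\<in>{x. a < u x \<and> u x < b}. ennreal (grad_modulus u x) \<partial>M)"
  proof (rule nn_integral_mono_AE)
    show "AE x in M. ennreal (grad_modulus w x)
        \<le> ennreal (grad_modulus u x) * indicator {x. a < u x \<and> u x < b} x"
      using level[OF w, of a] level[OF w, of b]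
    proof eventually_elim
      fix x assume x: "w x = a \<longrightarrow> grad_modulus w x = 0" "w x = b \<longrightarrow> grad_modulus w x = 0"
      show "ennreal (grad_modulus w x)
          \<le> ennreal (grad_modulus u x) * indicator {x. a < u x \<and> u x < b} x"
      proof (cases "a < u x \<and> u x < b")
        case True
        then show ?thesis
          using grad_modulus_contraction[OF u contr, of x] by (simp add: ennreal_leI)
      next
        case False
        then have "w x = a \<or> w x = b" using \<open>a \<le> b\<close> by (auto simp: w_def)
        then show ?thesis using x by auto
      qed
    qed
  qed
  finally show ?thesis .
qed

section \<open>Decreasing rearrangements\<close>

lemma decr_rearr_cong:
  assumes "\<And>l. 0 \<le> l \<Longrightarrow> measure M {x \<in> space M. l < \<bar>f x\<bar>} = measure N {x \<in> space N. l < \<bar>g x\<bar>}"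
  shows "decr_rearr M f = decr_rearr N g"
proof -
  have "{t. 0 \<le> t \<and> measure M {x \<in> space M. t < \<bar>f x\<bar>} \<le> s}
      = {t. 0 \<le> t \<and> measure N {x \<in> space N. t < \<bar>g x\<bar>} \<le> s}" for s
    using assms by auto
  then show ?thesis by (simp add: decr_rearr_def fun_eq_iff)
qed

context prob_space
begin

lemma small_superlevel:
  fixes u :: "'a \<Rightarrow> real"
  assumes [measurable]: "u \<in> borel_measurable M" and "0 < s"
  obtains l where "0 \<le> l" "prob {x \<in> space M. l < u x} < s"
proof -
  have empty: "(\<Inter>n. {x \<in> space M. real n < u x}) = {}"
  proof -
    have "\<exists>n. \<not> real n < u x" for x using real_arch_simple[of "u x"] by (auto simp: not_less)
    then show ?thesis by blast
  qed
  have "(\<lambda>n. prob {x \<in> space M. real n < u x}) \<longlonglongrightarrow> prob (\<Inter>n. {x \<in> space M. real n < u x})"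
    by (rule finite_Lim_measure_decseq) (auto simp: decseq_def)
  then have "(\<lambda>n. prob {x \<in> space M. real n < u x}) \<longlonglongrightarrow> 0" unfolding empty by simp
  then have "\<forall>\<^sub>F n in sequentially. prob {x \<in> space M. real n < u x} < s"
    using \<open>0 < s\<close> by (rule order_tendstoD)
  then obtain n where "prob {x \<in> space M. real n < u x} < s"
    unfolding eventually_sequentially by blast
  then show thesis using that[of "real n"] by simp
qed

text \<open>Right continuity of the distribution function \<open>l \<mapsto> prob {l < u}\<close>, as a one-sided
  criterion.\<close>

lemma prob_superlevel_le:
  fixes u :: "'a \<Rightarrow> real"
  assumes [measurable]: "u \<in> borel_measurable M"
    and le: "\<And>l'. l < l' \<Longrightarrow> prob {x \<in> space M. l' < u x} \<le> s"
  shows "prob {x \<in> space M. l < u x} \<le> s"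
proof -
  define e where "e n = inverse (real (Suc n))" for n
  have e_pos: "0 < e n" for n by (simp add: e_def)
  have e_antimono: "e n \<le> e m" if "m \<le> n" for m n using that by (simp add: e_def)
  define E where "E n = {x \<in> space M. l + e n < u x}" for n
  have E_sets: "E n \<in> sets M" for n unfolding E_def by measurable
  have Un: "(\<Union>n. E n) = {x \<in> space M. l < u x}"
  proof (intro equalityI subsetI)
    fix x assume x: "x \<in> {x \<in> space M. l < u x}"
    then obtain n where "e n < u x - l"
      unfolding e_def using reals_Archimedean[of "u x - l"] by auto
    with x have "x \<in> E n" by (simp add: E_def)
    then show "x \<in> (\<Union>n. E n)" by blast
  next
    fix x assume "x \<in> (\<Union>n. E n)"
    then obtain n where "x \<in> E n" by blast
    then show "x \<in> {x \<in> space M. l < u x}" using e_pos[of n] by (simp add: E_def)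
  qed
  have "incseq E"
  proof (intro monoI subsetI)
    fix m n :: nat and x assume "m \<le> n" "x \<in> E m"
    then show "x \<in> E n" using e_antimono[of m n] by (simp add: E_def)
  qed
  then have "(\<lambda>n. prob (E n)) \<longlonglongrightarrow> prob {x \<in> space M. l < u x}"
    unfolding Un[symmetric] using E_sets by (intro finite_Lim_measure_incseq) auto
  moreover have "prob (E n) \<le> s" for n
    using le[of "l + e n"] e_pos[of n] by (simp add: E_def)
  ultimately show ?thesis by (intro LIMSEQ_le_const2) auto
qed

lemma median_exists:
  fixes g :: "'a \<Rightarrow> real"
  assumes [measurable]: "g \<in> borel_measurable M"
  obtains m where "prob {x \<in> space M. m < g x} \<le> 1/2" "prob {x \<in> space M. g x < m} \<le> 1/2"
proof -
  define S where "S = {t. prob {x \<in> space M. t < g x} \<le> 1/2}"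
  \<comment> \<open>\<open>Inf S\<close> is the least median.\<close>
  have S_up: "t' \<in> S" if "t \<in> S" "t \<le> t'" for t t'
  proof -
    have "prob {x \<in> space M. t' < g x} \<le> prob {x \<in> space M. t < g x}"
      using that(2) by (intro finite_measure_mono) auto
    then show ?thesis using that(1) by (simp add: S_def)
  qed
  have half: "prob {x \<in> space M. g x < c} \<le> 1/2" if "c \<notin> S" for c
  proof -
    have "prob {x \<in> space M. g x < c} \<le> prob (space M - {x \<in> space M. c < g x})"
      by (intro finite_measure_mono) auto
    also have "\<dots> = 1 - prob {x \<in> space M. c < g x}" by (intro prob_compl) auto
    finally show ?thesis using that by (simp add: S_def)
  qed
  obtain p where "prob {x \<in> space M. p < g x} < 1/2" using small_superlevel[of g "1/2"] by auto
  then have "p \<in> S" by (simp add: S_def)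
  then have nonempty: "S \<noteq> {}" by blast
  obtain q where q: "prob {x \<in> space M. q < - g x} < 1/2"
    using small_superlevel[of "\<lambda>x. - g x" "1/2"] by auto
  have "- q - 1 \<notin> S"
  proof
    assume "- q - 1 \<in> S"
    have "1 = prob (space M)" by (simp add: prob_space)
    also have "\<dots> \<le> prob ({x \<in> space M. q < - g x} \<union> {x \<in> space M. - q - 1 < g x})"
      by (intro finite_measure_mono) auto
    also have "\<dots> \<le> prob {x \<in> space M. q < - g x} + prob {x \<in> space M. - q - 1 < g x}"
      by (intro measure_Un_le) auto
    finally show False using q \<open>- q - 1 \<in> S\<close> by (simp add: S_def)
  qed
  then have bdd: "bdd_below S"
    using S_up by (intro bdd_belowI[of _ "- q - 1"]) (meson linear)
  have "prob {x \<in> space M. Inf S < g x} \<le> 1/2"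
  proof (rule prob_superlevel_le)
    fix l assume "Inf S < l"
    then obtain t where "t \<in> S" "t < l" using cInf_lessD[OF nonempty] by blast
    then have "l \<in> S" using S_up by auto
    then show "prob {x \<in> space M. l < g x} \<le> 1/2" by (simp add: S_def)
  qed simp
  moreover have "prob {x \<in> space M. - Inf S < - g x} \<le> 1/2"
  proof (rule prob_superlevel_le)
    fix l assume "- Inf S < l"
    then have "- l \<notin> S" using cInf_lower[OF _ bdd, of "- l"] by auto
    then show "prob {x \<in> space M. l < - g x} \<le> 1/2"
      using half[of "- l"] by (simp add: less_minus_iff)
  qed simp
  ultimately show thesis using that[of "Inf S"] by simp
qed

text \<open>The Galois connection between the rearrangement and the distribution function. Right
  continuity of the latter means that the infimum defining the rearrangement is attained.\<close>

lemma decr_rearr_le_iff: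
  assumes [measurable]: "u \<in> borel_measurable M" and s: "0 < s" and l: "0 \<le> l"
  shows "decr_rearr M u s \<le> l \<longleftrightarrow> prob {x \<in> space M. l < \<bar>u x\<bar>} \<le> s"
proof
  define S where "S = {t. 0 \<le> t \<and> prob {x \<in> space M. t < \<bar>u x\<bar>} \<le> s}"
  have bdd: "bdd_below S" by (auto simp: S_def intro: bdd_belowI[of _ 0])
  assume "prob {x \<in> space M. l < \<bar>u x\<bar>} \<le> s"
  then show "decr_rearr M u s \<le> l"
    using l bdd unfolding decr_rearr_def S_def[symmetric]
    by (intro cInf_lower) (auto simp: S_def)
next
  define S where "S = {t. 0 \<le> t \<and> prob {x \<in> space M. t < \<bar>u x\<bar>} \<le> s}"
  obtain t where "0 \<le> t" "prob {x \<in> space M. t < \<bar>u x\<bar>} < s"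
    using small_superlevel[of "\<lambda>x. \<bar>u x\<bar>" s] s by auto
  then have "t \<in> S" by (simp add: S_def)
  then have nonempty: "S \<noteq> {}" by blast
  assume le: "decr_rearr M u s \<le> l"
  show "prob {x \<in> space M. l < \<bar>u x\<bar>} \<le> s"
  proof (rule prob_superlevel_le)
    fix l' assume "l < l'"
    then have "Inf S < l'"
      using le unfolding decr_rearr_def S_def[symmetric] by simp
    then obtain t where t: "t \<in> S" "t < l'"
      using cInf_lessD[OF nonempty] by blast
    have "prob {x \<in> space M. l' < \<bar>u x\<bar>} \<le> prob {x \<in> space M. t < \<bar>u x\<bar>}"
      using t(2) by (intro finite_measure_mono) auto
    then show "prob {x \<in> space M. l' < \<bar>u x\<bar>} \<le> s" using t(1) by (simp add: S_def)
  qed simp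
qed

lemma less_decr_rearr_iff:
  assumes "u \<in> borel_measurable M" "0 < s" "0 \<le> l"
  shows "l < decr_rearr M u s \<longleftrightarrow> s < prob {x \<in> space M. l < \<bar>u x\<bar>}"
  using decr_rearr_le_iff[OF assms] by (simp add: not_le[symmetric])

lemma decr_rearr_nonneg:
  assumes "u \<in> borel_measurable M" "0 < s"
  shows "0 \<le> decr_rearr M u s"
proof (rule ccontr)
  assume neg: "\<not> 0 \<le> decr_rearr M u s"
  then have "prob {x \<in> space M. 0 < \<bar>u x\<bar>} \<le> s" using decr_rearr_le_iff[OF assms, of 0] by simp
  then have "{t. 0 \<le> t \<and> prob {x \<in> space M. t < \<bar>u x\<bar>} \<le> s} \<noteq> {}"
    by (auto intro!: exI[of _ 0])
  then have "0 \<le> decr_rearr M u s" unfolding decr_rearr_def by (rule cInf_greatest) simp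
  with neg show False by simp
qed

lemma prob_superlevel_decr_rearr_le:
  assumes "u \<in> borel_measurable M" "0 < s"
  shows "prob {x \<in> space M. decr_rearr M u s < \<bar>u x\<bar>} \<le> s"
  using decr_rearr_le_iff[OF assms decr_rearr_nonneg[OF assms]] by simp

lemma decr_rearr_antimono:
  assumes "u \<in> borel_measurable M" "0 < s" "s \<le> s'"
  shows "decr_rearr M u s' \<le> decr_rearr M u s"
  using prob_superlevel_decr_rearr_le[of u s] assms
  by (subst decr_rearr_le_iff) (auto intro: decr_rearr_nonneg)

text \<open>Let \<open>t \<le> 1\<close>. The set lies inside \<open>{u\<^sup>* t' < u}\<close>, of measure at most \<open>t'\<close>, and outside
  \<open>{u\<^sup>* t \<le> u}\<close>, of measure at least \<open>t\<close>. Both inequalities may be strict, since \<open>u\<close> may have level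
  sets of positive measure.\<close>

lemma prob_between_decr_rearr_le:
  assumes [measurable]: "u \<in> borel_measurable M" and nonneg: "\<And>x. x \<in> space M \<Longrightarrow> 0 \<le> u x"
    and t: "0 < t" "t \<le> t'"
  shows "prob {x \<in> space M. decr_rearr M u t' < u x \<and> u x < decr_rearr M u t} \<le> t' - t"
proof -
  define a where "a = decr_rearr M u t'"
  define b where "b = decr_rearr M u t"
  have a: "0 \<le> a" using t unfolding a_def by (intro decr_rearr_nonneg) auto
  have below: "prob {x \<in> space M. a < u x \<and> u x < c} \<le> t' - t" if c: "c < b" for c
  proof (cases "a < c")
    case True
    have "t < prob {x \<in> space M. c < \<bar>u x\<bar>}"
      using True a t(1) c by (subst less_decr_rearr_iff[symmetric]) (auto simp: b_def)
    moreover have "prob {x \<in> space M. a < \<bar>u x\<bar>} \<le> t'"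
      using t unfolding a_def by (intro prob_superlevel_decr_rearr_le) auto
    moreover have "prob {x \<in> space M. a < u x \<and> u x < c}
        \<le> prob ({x \<in> space M. a < \<bar>u x\<bar>} - {x \<in> space M. c < \<bar>u x\<bar>})"
      using nonneg by (intro finite_measure_mono) auto
    moreover have "\<dots> = prob {x \<in> space M. a < \<bar>u x\<bar>} - prob {x \<in> space M. c < \<bar>u x\<bar>}"
      using True by (intro finite_measure_Diff) auto
    ultimately show ?thesis by simp
  next
    case False
    then have empty: "{x \<in> space M. a < u x \<and> u x < c} = {}" by auto
    show ?thesis unfolding empty using t by simp
  qed
  \<comment> \<open>The passage \<open>c \<rightarrow> b\<close> from below becomes right continuity for this auxiliary function.\<close>
  have eq: "{x \<in> space M. - c < (if a < u x then - u x else - b)} = {x \<in> space M. a < u x \<and> u x < c}"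
    if "c \<le> b" for c
    using that by auto
  have "prob {x \<in> space M. - b < (if a < u x then - u x else - b)} \<le> t' - t"
  proof (rule prob_superlevel_le)
    fix l' assume "- b < l'"
    then show "prob {x \<in> space M. l' < (if a < u x then - u x else - b)} \<le> t' - t"
      using eq[of "- l'"] below[of "- l'"] by simp
  qed simp
  then show ?thesis unfolding a_def[symmetric] b_def[symmetric] using eq[of b] by simp
qed

end

lemma measure_unit_interval:
  assumes "A \<in> sets borel" "A \<subseteq> {0<..<1}"
  shows "measure unit_interval A = measure lborel A"
  using assms by (simp add: measure_restrict_space)

lemma mono_on_measurable_unit_interval:
  fixes f :: "real \<Rightarrow> real"
  assumes "mono_on {0<..<1} f"
  shows "f \<in> borel_measurable unit_interval"
proof (rule borel_measurable_subalgebra[OF _ _ borel_measurable_mono_on_fnc[OF assms]])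
  show "sets (restrict_space borel {0<..<1::real}) \<subseteq> sets unit_interval"
    by (auto simp: sets_restrict_space intro!: imageI)
qed (simp add: space_restrict_space)

lemma antimono_on_measurable_unit_interval:
  fixes f :: "real \<Rightarrow> real"
  assumes "\<And>s t. 0 < s \<Longrightarrow> s \<le> t \<Longrightarrow> t < 1 \<Longrightarrow> f t \<le> f s"
  shows "f \<in> borel_measurable unit_interval"
proof -
  have "(\<lambda>s. - f s) \<in> borel_measurable unit_interval"
    using assms by (intro mono_on_measurable_unit_interval mono_onI) auto
  then have "(\<lambda>s. - (- f s)) \<in> borel_measurable unit_interval"
    by (rule borel_measurable_uminus)
  then show ?thesis by simp
qed

context prob_space
begin

lemma decr_rearr_measurable:
  assumes "u \<in> borel_measurable M"
  shows "decr_rearr M u \<in> borel_measurable unit_interval"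
  by (intro antimono_on_measurable_unit_interval decr_rearr_antimono assms)

lemma superlevel_decr_rearr:
  assumes "u \<in> borel_measurable M" "0 \<le> l"
  shows "{s \<in> {0<..<1}. l < \<bar>decr_rearr M u s\<bar>} = {0<..<prob {x \<in> space M. l < \<bar>u x\<bar>}}"
proof -
  have "l < \<bar>decr_rearr M u s\<bar> \<longleftrightarrow> s < prob {x \<in> space M. l < \<bar>u x\<bar>}" if "0 < s" for s
    using decr_rearr_nonneg[OF assms(1) that] less_decr_rearr_iff[OF assms(1) that assms(2)] by simp
  moreover have "s < 1" if "s < prob {x \<in> space M. l < \<bar>u x\<bar>}" for s
    using that prob_le_1 by (rule less_le_trans)
  ultimately show ?thesis by auto
qed

lemma decr_rearr_decr_rearr:
  assumes "u \<in> borel_measurable M"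
  shows "decr_rearr unit_interval (decr_rearr M u) = decr_rearr M u"
proof (rule decr_rearr_cong)
  fix l :: real assume "0 \<le> l"
  then have "{s \<in> space unit_interval. l < \<bar>decr_rearr M u s\<bar>} = {0<..<prob {x \<in> space M. l < \<bar>u x\<bar>}}"
    using superlevel_decr_rearr[OF assms] by (simp add: space_restrict_space)
  then show "measure unit_interval {s \<in> space unit_interval. l < \<bar>decr_rearr M u s\<bar>}
      = prob {x \<in> space M. l < \<bar>u x\<bar>}"
    by (simp add: measure_unit_interval greaterThanLessThan_subseteq_greaterThanLessThan)
qed

end

section \<open>Piecewise increasing rearrangement\<close>

context prob_space
begin

text \<open>On each interval \<open>{a j<..<b j}\<close> the function \<open>\<phi>\<close> is the increasing rearrangement of
  \<open>h\<close> restricted to \<open>A j\<close>, pushed against the right end of the interval. All its later properties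
  are read off from its superlevel sets.\<close>

lemma piecewise_increasing_rearrangement:
  fixes h :: "'a \<Rightarrow> real" and A :: "nat \<Rightarrow> 'a set" and a b :: "nat \<Rightarrow> real"
  assumes [measurable]: "h \<in> borel_measurable M" "\<And>j. A j \<in> sets M"
    and nonneg: "\<And>x. x \<in> space M \<Longrightarrow> 0 \<le> h x"
    and disj: "disjoint_family (\<lambda>j. {a j<..<b j})"
    and size: "\<And>j. prob (A j) \<le> b j - a j"
  obtains \<phi> where "\<And>s. 0 \<le> \<phi> s"
    "\<And>l. 0 \<le> l \<Longrightarrow> {s. l < \<phi> s} = (\<Union>j. {b j - prob {x \<in> A j. l < h x}<..<b j})"
proof -
  define r where "r j = decr_rearr M (\<lambda>x. h x * indicator (A j) x)" for j
  define \<phi> where "\<phi> s = (if \<exists>j. s \<in> {a j<..<b j} then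
      let j = (SOME j. s \<in> {a j<..<b j}) in r j (b j - s) else 0)" for s
  have \<phi>_eq: "\<phi> s = r j (b j - s)" if s: "s \<in> {a j<..<b j}" for s j
  proof -
    have uniq: "i = j" if "s \<in> {a i<..<b i}" for i
    proof (rule ccontr)
      assume "i \<noteq> j"
      then have "{a i<..<b i} \<inter> {a j<..<b j} = {}"
        by (intro disjoint_family_onD[OF disj]) auto
      with s that show False by blast
    qed
    have "(SOME j. s \<in> {a j<..<b j}) = j" using s uniq by (rule some_equality)
    moreover have "\<exists>j. s \<in> {a j<..<b j}" using s by (rule exI)
    ultimately show ?thesis by (simp only: \<phi>_def Let_def if_True)
  qed
  have r_meas: "(\<lambda>x. h x * indicator (A j) x) \<in> borel_measurable M" for j by measurable
  have "0 \<le> \<phi> s" for s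
  proof (cases "\<exists>j. s \<in> {a j<..<b j}")
    case True
    then obtain j where "s \<in> {a j<..<b j}" by blast
    then show ?thesis using \<phi>_eq[of s j] decr_rearr_nonneg[OF r_meas] by (simp add: r_def)
  qed (auto simp: \<phi>_def)
  moreover have "{s. l < \<phi> s} = (\<Union>j. {b j - prob {x \<in> A j. l < h x}<..<b j})" if l: "0 \<le> l" for l
  proof -
    have sub: "A j \<subseteq> space M" for j using sets.sets_into_space[OF assms(2)] .
    have D: "{x \<in> space M. l < \<bar>h x * indicator (A j) x\<bar>} = {x \<in> A j. l < h x}" for j
      using nonneg sub[of j] l by (auto simp: indicator_def split: if_splits)
    have D_le: "prob {x \<in> A j. l < h x} \<le> b j - a j" for j
      by (rule order_trans[OF _ size[of j]]) (intro finite_measure_mono; auto)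
    have r_iff: "l < r j (b j - s) \<longleftrightarrow> b j - s < prob {x \<in> A j. l < h x}" if "s < b j" for j s
      using less_decr_rearr_iff[OF r_meas, of "b j - s" l j] that l by (simp add: r_def D)
    show ?thesis
    proof (intro equalityI subsetI)
      fix s assume s: "s \<in> {s. l < \<phi> s}"
      then have "\<exists>j. s \<in> {a j<..<b j}" using l by (auto simp: \<phi>_def split: if_splits)
      then obtain j where j: "s \<in> {a j<..<b j}" by blast
      then have "s \<in> {b j - prob {x \<in> A j. l < h x}<..<b j}"
        using \<phi>_eq[OF j] r_iff[of s j] s by auto
      then show "s \<in> (\<Union>j. {b j - prob {x \<in> A j. l < h x}<..<b j})" by blast
    next
      fix s assume "s \<in> (\<Union>j. {b j - prob {x \<in> A j. l < h x}<..<b j})"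
      then obtain j where j: "b j - prob {x \<in> A j. l < h x} < s" "s < b j" by auto
      then have "s \<in> {a j<..<b j}" using D_le[of j] by auto
      then show "s \<in> {s. l < \<phi> s}" using \<phi>_eq[of s j] r_iff[of s j] j by auto
    qed
  qed
  ultimately show thesis using that by blast
qed

text \<open>The last conclusion is where the increasing order within an interval matters: the largest
  values of \<open>h\<close> on \<open>A j\<close> sit next to \<open>b j\<close>, so \<open>{t<..<b j}\<close> carries at least the mass of any subset of
  \<open>A j\<close> of measure \<open>b j - t\<close>. It is proved level by level with the layer-cake formula, since
  at height \<open>l\<close> the two sides are at most, respectively at least, the minimum of \<open>b j - t\<close> and the
  measure of \<open>{x \<in> A j. l < h x}\<close>.\<close>

lemma rearrange_onto_intervals:
  fixes h :: "'a \<Rightarrow> real" and A :: "nat \<Rightarrow> 'a set" and a b :: "nat \<Rightarrow> real"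
  assumes h [measurable]: "h \<in> borel_measurable M" and A [measurable]: "\<And>j. A j \<in> sets M"
    and nonneg: "\<And>x. x \<in> space M \<Longrightarrow> 0 \<le> h x"
    and disj_A: "disjoint_family A" and disj: "disjoint_family (\<lambda>j. {a j<..<b j})"
    and bounds: "\<And>j. 0 \<le> a j" "\<And>j. b j \<le> 1"
    and size: "\<And>j. prob (A j) \<le> b j - a j"
  obtains \<phi> where "\<phi> \<in> borel_measurable borel" "\<And>s. 0 \<le> \<phi> s"
    "\<And>L s. \<forall>x\<in>space M. h x \<le> L \<Longrightarrow> 0 \<le> L \<Longrightarrow> \<phi> s \<le> L"
    "decr_rearr unit_interval \<phi> = decr_rearr M (\<lambda>x. h x * indicator (\<Union>j. A j) x)"
    "\<And>E t j. E \<in> sets M \<Longrightarrow> E \<subseteq> A j \<Longrightarrow> prob E \<le> b j - t \<Longrightarrow>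
        (\<integral>\<^sup>+x\<in>E. ennreal (h x) \<partial>M) \<le> (\<integral>\<^sup>+s\<in>{t<..<b j}. ennreal (\<phi> s) \<partial>lborel)"
proof -
  obtain \<phi> where \<phi>_nonneg: "\<And>s. 0 \<le> \<phi> s"
    and superlevel_prob: "\<And>l. 0 \<le> l \<Longrightarrow> {s. l < \<phi> s} = (\<Union>j. {b j - prob {x \<in> A j. l < h x}<..<b j})"
    by (rule piecewise_increasing_rearrangement[OF h A _ disj size]) (erule nonneg, rule that)
  define D where "D j l = prob {x \<in> A j. l < h x}" for j l
  have superlevel: "{s. l < \<phi> s} = (\<Union>j. {b j - D j l<..<b j})" if "0 \<le> l" for l
    using superlevel_prob[OF that] by (simp add: D_def)
  have sub: "A j \<subseteq> space M" for j using sets.sets_into_space[OF A] .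
  have level_sets: "{x \<in> A j. l < h x} \<in> sets M" for j l
  proof -
    have "{x \<in> A j. l < h x} = A j \<inter> {x \<in> space M. l < h x}" using sub[of j] by auto
    also have "\<dots> \<in> sets M" by measurable
    finally show ?thesis .
  qed
  have D_le: "D j l \<le> b j - a j" for j l
    unfolding D_def by (rule order_trans[OF _ size[of j]], rule finite_measure_mono) auto
  have D_nonneg: "0 \<le> D j l" for j l by (simp add: D_def)
  have \<phi>_meas [measurable]: "\<phi> \<in> borel_measurable borel"
  proof (rule borel_measurableI_greater)
    fix l
    have "open {s. l < \<phi> s}"
    proof (cases "0 \<le> l")
      case False
      then have "l < \<phi> s" for s using \<phi>_nonneg[of s] by linarith
      then have "{s. l < \<phi> s} = UNIV" by simp
      then show ?thesis by simp
    qed (simp add: superlevel open_UN)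
    then show "{s \<in> space borel. l < \<phi> s} \<in> sets borel" by simp
  qed
  have \<phi>_le: "\<phi> s \<le> L" if "\<forall>x\<in>space M. h x \<le> L" "0 \<le> L" for L s
  proof -
    have "{x \<in> A j. L < h x} = {}" for j using that(1) sub[of j] by (auto simp: not_less)
    then have "D j L = 0" for j unfolding D_def by (simp only: measure_empty)
    then have "{s. L < \<phi> s} = {}" using superlevel[OF that(2)] by auto
    then show ?thesis by (auto simp: not_less)
  qed
  have equimeasurable: "decr_rearr unit_interval \<phi> = decr_rearr M (\<lambda>x. h x * indicator (\<Union>j. A j) x)"
  proof (rule decr_rearr_cong)
    fix l :: real assume l: "0 \<le> l"
    let ?I = "\<lambda>j. {b j - D j l<..<b j}" and ?S = "\<lambda>j. {x \<in> A j. l < h x}"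
    have I_sub: "?I j \<subseteq> {a j<..<b j}" for j using D_le[of j l] by auto
    have "disjoint_family ?I" by (rule disjoint_family_subset[OF disj I_sub])
    then have "emeasure lborel (\<Union>j. ?I j) = (\<Sum>j. emeasure lborel (?I j))"
      by (intro suminf_emeasure[symmetric]) auto
    also have "\<dots> = (\<Sum>j. emeasure M (?S j))"
    proof -
      have "emeasure lborel (?I j) = ennreal (D j l)" for j using D_nonneg[of j l] by simp
      then show ?thesis by (simp only: D_def emeasure_eq_measure)
    qed
    also have "\<dots> = emeasure M (\<Union>j. ?S j)"
    proof (rule suminf_emeasure)
      show "disjoint_family ?S" by (rule disjoint_family_subset[OF disj_A]) auto
    qed (use level_sets in auto)
    finally have "measure lborel (\<Union>j. ?I j) = prob (\<Union>j. ?S j)" by (simp add: measure_def)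
    moreover have I_unit: "(\<Union>j. ?I j) \<subseteq> {0<..<1}"
    proof (rule UN_least)
      fix j
      have "{a j<..<b j} \<subseteq> {0<..<1}" using bounds(1)[of j] bounds(2)[of j] by auto
      with I_sub[of j] show "?I j \<subseteq> {0<..<1}" by (rule subset_trans)
    qed
    moreover have "{s \<in> space unit_interval. l < \<bar>\<phi> s\<bar>} = (\<Union>j. ?I j)"
    proof -
      have "{s \<in> space unit_interval. l < \<bar>\<phi> s\<bar>} = {0<..<1} \<inter> {s. l < \<phi> s}"
        using \<phi>_nonneg by (auto simp: space_restrict_space)
      then show ?thesis unfolding superlevel[OF l] using I_unit by (simp only: Int_absorb1)
    qed
    moreover have "{x \<in> space M. l < \<bar>h x * indicator (\<Union>j. A j) x\<bar>} = (\<Union>j. ?S j)"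
    proof (intro equalityI subsetI)
      fix x assume x: "x \<in> {x \<in> space M. l < \<bar>h x * indicator (\<Union>j. A j) x\<bar>}"
      then have "x \<in> (\<Union>j. A j)" using l by (cases "x \<in> (\<Union>j. A j)") simp_all
      then show "x \<in> (\<Union>j. ?S j)" using x nonneg[of x] by simp
    next
      fix x assume "x \<in> (\<Union>j. ?S j)"
      then obtain j where j: "x \<in> A j" "l < h x" by blast
      then have "x \<in> space M" "x \<in> (\<Union>j. A j)" using sub[of j] by blast+
      then show "x \<in> {x \<in> space M. l < \<bar>h x * indicator (\<Union>j. A j) x\<bar>}" using j by simp
    qed
    moreover have "measure unit_interval (\<Union>j. ?I j) = measure lborel (\<Union>j. ?I j)"
      using I_unit by (intro measure_unit_interval) auto
    ultimately show "measure unit_interval {s \<in> space unit_interval. l < \<bar>\<phi> s\<bar>}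
        = prob {x \<in> space M. l < \<bar>h x * indicator (\<Union>j. A j) x\<bar>}"
      by (simp only:)
  qed
  have mass: "(\<integral>\<^sup>+x\<in>E. ennreal (h x) \<partial>M) \<le> (\<integral>\<^sup>+s\<in>{t<..<b j}. ennreal (\<phi> s) \<partial>lborel)"
    if E [measurable]: "E \<in> sets M" and EA: "E \<subseteq> A j" and Et: "prob E \<le> b j - t" for E t j
  proof -
    have "(\<integral>\<^sup>+x\<in>E. ennreal (h x) \<partial>M) = (\<integral>\<^sup>+x. ennreal (h x * indicator E x - 0) \<partial>M)"
      by (intro nn_integral_cong) (auto simp: indicator_def)
    also have "\<dots> = (\<integral>\<^sup>+l. emeasure M {x \<in> space M. 0 \<le> l \<and> l < h x * indicator E x} \<partial>lborel)"
      by (rule nn_integral_between_graphs) (auto intro: sigma_finite_measure_axioms)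
    also have "\<dots> \<le> (\<integral>\<^sup>+l. emeasure lborel
        {s \<in> space lborel. 0 \<le> l \<and> l < \<phi> s * indicator {t<..<b j} s} \<partial>lborel)"
    proof (rule nn_integral_mono)
      fix l :: real
      show "emeasure M {x \<in> space M. 0 \<le> l \<and> l < h x * indicator E x}
          \<le> emeasure lborel {s \<in> space lborel. 0 \<le> l \<and> l < \<phi> s * indicator {t<..<b j} s}"
      proof (cases "0 \<le> l")
        case True
        let ?S = "{x \<in> space M. 0 \<le> l \<and> l < h x * indicator E x}"
        have S_E: "prob ?S \<le> prob E" using True
          by (intro finite_measure_mono) (auto simp: indicator_def split: if_splits)
        have S_D: "prob ?S \<le> D j l" unfolding D_def using True EA level_sets
          by (intro finite_measure_mono) (auto simp: indicator_def split: if_splits)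
        have "l < \<phi> s" if "s \<in> {b j - D j l<..<b j}" for s
          using superlevel[OF True] that by blast
        then have "{max t (b j - D j l)<..<b j}
            \<subseteq> {s \<in> space lborel. 0 \<le> l \<and> l < \<phi> s * indicator {t<..<b j} s}"
          using True by (auto simp: max_less_iff_conj)
        then have upper: "emeasure lborel {max t (b j - D j l)<..<b j}
            \<le> emeasure lborel {s \<in> space lborel. 0 \<le> l \<and> l < \<phi> s * indicator {t<..<b j} s}"
          by (rule emeasure_mono) measurable
        have "t \<le> b j" using Et measure_nonneg[of M E] by linarith
        then have eq: "emeasure lborel {max t (b j - D j l)<..<b j} = ennreal (min (b j - t) (D j l))"
          using D_nonneg[of j l] by (simp add: max_def min_def)
        have lower: "emeasure M ?S \<le> ennreal (min (b j - t) (D j l))"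
          unfolding emeasure_eq_measure using S_E S_D Et by (intro ennreal_leI) simp
        show ?thesis using lower upper unfolding eq by (rule order_trans)
      qed simp
    qed
    also have "\<dots> = (\<integral>\<^sup>+s. ennreal (\<phi> s * indicator {t<..<b j} s - 0) \<partial>lborel)"
      by (rule nn_integral_between_graphs[symmetric]) (auto intro: sigma_finite_lborel)
    also have "\<dots> = (\<integral>\<^sup>+s\<in>{t<..<b j}. ennreal (\<phi> s) \<partial>lborel)"
      by (intro nn_integral_cong) (auto simp: indicator_def)
    finally show ?thesis .
  qed
  show thesis using that[OF \<phi>_meas \<phi>_nonneg \<phi>_le equimeasurable mass] .
qed

end

section \<open>The isoperimetric Hardy operator controls the rearrangement\<close>

context
  fixes M :: "'a::metric_space measure" and I :: "real \<Rightarrow> real"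
  assumes estimator: "convex_isoperimetric_estimator M I"
begin

lemma estimator_pos: "0 < t \<Longrightarrow> t < 1 \<Longrightarrow> 0 < I t"
  using estimator by (simp add: convex_isoperimetric_estimator_def)

lemma estimator_continuous: "continuous_on {0..1} I"
  using estimator by (simp add: convex_isoperimetric_estimator_def)

lemma estimator_mono:
  assumes "0 \<le> s" "s \<le> t" "t \<le> 1/2"
  shows "I s \<le> I t"
proof -
  have mono: "I s \<le> I t" if "0 < s" "s \<le> t" "t < 1/2" for s t
    using estimator that by (auto simp: convex_isoperimetric_estimator_def intro: mono_onD)
  consider "s = 0" | "s = t" | "0 < s" "s < t" "t < 1/2" | "0 < s" "s < t" "t = 1/2"
    using assms by fastforce
  then show ?thesis
  proof cases
    case 1
    then show ?thesis
      using estimator assms by (auto simp: convex_isoperimetric_estimator_def)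
  next
    case 4
    have closure: "closure {s<..<1/2} = {s..1/2}" using 4 by (intro closure_greaterThanLessThan) simp
    show ?thesis
    proof (rule continuous_ge_on_closure[of "{s<..<1/2}" I])
      show "continuous_on (closure {s<..<1/2}) I"
        unfolding closure using 4 by (intro continuous_on_subset[OF estimator_continuous]) auto
      show "t \<in> closure {s<..<1/2}" unfolding closure using 4 by simp
      show "\<And>x. x \<in> {s<..<1/2} \<Longrightarrow> I s \<le> I x" using 4 by (auto intro: mono)
    qed
  qed (use mono in auto)
qed

lemma divide_estimator_measurable:
  assumes [measurable]: "\<phi> \<in> borel_measurable borel"
  shows "(\<lambda>s. \<phi> s / I s * indicator {0..1} s) \<in> borel_measurable borel"
proof -
  have [measurable]: "(\<lambda>s. indicator {0..1} s *\<^sub>R I s) \<in> borel_measurable borel"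
    using estimator_continuous by (intro borel_measurable_continuous_on_indicator) auto
  have "(\<lambda>s. \<phi> s / I s * indicator {0..1} s) = (\<lambda>s. \<phi> s / (indicator {0..1} s *\<^sub>R I s) * indicator {0..1} s)"
    by (auto simp: fun_eq_iff indicator_def)
  also have "\<dots> \<in> borel_measurable borel" by measurable
  finally show ?thesis .
qed

text \<open>For bounded \<open>\<phi>\<close> the integral defining the operator is finite, so that it agrees with the
  nonnegative integral, which is additive and monotone without side conditions.\<close>

lemma isoperimetric_hardy_eq_nn_integral:
  assumes \<phi> [measurable]: "\<phi> \<in> borel_measurable borel" and bounds: "\<And>s. 0 \<le> \<phi> s" "\<And>s. \<phi> s \<le> L"
    and t: "0 < t" "t < 1/2"
  shows "ennreal (isoperimetric_hardy I \<phi> t) = (\<integral>\<^sup>+s\<in>{t..1/2}. ennreal (\<phi> s / I s) \<partial>lborel)"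
    and "0 \<le> isoperimetric_hardy I \<phi> t"
proof -
  define f where "f s = indicator {t..1/2} s * (\<phi> s / I s)" for s
  have f_eq: "f s = indicator {t..1/2} s * (\<phi> s / I s * indicator {0..1} s)" for s
    using t by (auto simp: f_def indicator_def)
  have f_meas [measurable]: "f \<in> borel_measurable borel"
    unfolding f_eq [abs_def] using divide_estimator_measurable[OF \<phi>] by measurable
  have It: "0 < I t" using t by (intro estimator_pos) auto
  have I_ge: "I t \<le> I s" if "s \<in> {t..1/2}" for s using t that by (intro estimator_mono) auto
  have f_nonneg: "0 \<le> f s" for s
    using bounds(1)[of s] It I_ge[of s] by (auto simp: f_def indicator_def)
  have f_le: "f s \<le> L / I t * indicator {t..1/2} s" for s
  proof (cases "s \<in> {t..1/2}")
    case True
    have "\<phi> s / I s \<le> L / I t"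
      using bounds[of s] It I_ge[OF True] by (intro frac_le) auto
    then show ?thesis using True by (simp add: f_def)
  qed (simp add: f_def)
  have "(\<integral>\<^sup>+s. ennreal (f s) \<partial>lborel) \<le> (\<integral>\<^sup>+s. ennreal (L / I t) * indicator {t..1/2} s \<partial>lborel)"
  proof (rule nn_integral_mono)
    fix s
    have "ennreal (f s) \<le> ennreal (L / I t * indicator {t..1/2} s)" by (rule ennreal_leI[OF f_le])
    then show "ennreal (f s) \<le> ennreal (L / I t) * indicator {t..1/2} s"
      by (cases "s \<in> {t..1/2}") simp_all
  qed
  also have "\<dots> < \<infinity>"
    by (simp add: nn_integral_cmult_indicator ennreal_mult_less_top emeasure_lborel_Icc_eq)
  finally have int: "integrable lborel f"
    using f_nonneg by (intro integrableI_nonneg) auto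
  have hardy: "isoperimetric_hardy I \<phi> t = integral\<^sup>L lborel f"
  proof -
    have "isoperimetric_hardy I \<phi> t = integral\<^sup>L lebesgue f"
      using t by (simp add: isoperimetric_hardy_def set_lebesgue_integral_def f_def [abs_def])
    then show ?thesis using f_meas by (simp add: integral_completion)
  qed
  then show "0 \<le> isoperimetric_hardy I \<phi> t" using f_nonneg by (simp add: integral_nonneg_AE)
  have "ennreal (isoperimetric_hardy I \<phi> t) = (\<integral>\<^sup>+s. ennreal (f s) \<partial>lborel)"
    unfolding hardy using int f_nonneg by (intro nn_integral_eq_integral[symmetric]) auto
  also have "\<dots> = (\<integral>\<^sup>+s\<in>{t..1/2}. ennreal (\<phi> s / I s) \<partial>lborel)"
    by (intro nn_integral_cong) (auto simp: f_def indicator_def)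
  finally show "ennreal (isoperimetric_hardy I \<phi> t)
      = (\<integral>\<^sup>+s\<in>{t..1/2}. ennreal (\<phi> s / I s) \<partial>lborel)" .
qed

lemma isoperimetric_hardy_measurable:
  assumes "\<phi> \<in> borel_measurable borel" "\<And>s. 0 \<le> \<phi> s" "\<And>s. \<phi> s \<le> L"
  shows "isoperimetric_hardy I \<phi> \<in> borel_measurable unit_interval"
proof (rule antimono_on_measurable_unit_interval)
  fix s t :: real assume st: "0 < s" "s \<le> t" "t < 1"
  note Q = isoperimetric_hardy_eq_nn_integral[OF assms]
  show "isoperimetric_hardy I \<phi> t \<le> isoperimetric_hardy I \<phi> s"
  proof (cases "t < 1/2")
    case True
    have "ennreal (isoperimetric_hardy I \<phi> t) \<le> ennreal (isoperimetric_hardy I \<phi> s)"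
      using st True by (subst (1 2) Q(1)) (auto intro!: nn_integral_mono simp: indicator_def)
    then show ?thesis using Q(2)[of s] st True by (simp add: ennreal_le_iff)
  next
    case False
    then show ?thesis
      using Q(2)[of s] st by (cases "s < 1/2") (auto simp: isoperimetric_hardy_def)
  qed
qed

text \<open>The points where the estimator takes the values \<open>I (1/2) / 2 ^ j\<close>. Between consecutive
  points \<open>I\<close> is constant up to a factor two, however fast it vanishes at the origin.\<close>

lemma estimator_halving_points:
  obtains T :: "nat \<Rightarrow> real" where "\<And>j. 0 < T j" "\<And>j. T j \<le> 1/2" "T 0 = 1/2" "\<And>j. T (Suc j) < T j"
    "\<And>j. I (T j) = 2 * I (T (Suc j))" "\<And>t. 0 < t \<Longrightarrow> t < 1/2 \<Longrightarrow> \<exists>j. T j < t"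
proof -
  have half: "0 < I (1/2)" by (rule estimator_pos) auto
  have I0: "I 0 = 0" using estimator by (simp add: convex_isoperimetric_estimator_def)
  have "\<exists>t. 0 < t \<and> t \<le> 1/2 \<and> I t = I (1/2) / 2 ^ j \<and> (j = 0 \<longrightarrow> t = 1/2)" for j :: nat
  proof (cases "j = 0")
    case False
    have "\<exists>t\<ge>0. t \<le> 1/2 \<and> I t = I (1/2) / 2 ^ j"
      using half I0
      by (intro IVT' continuous_on_subset[OF estimator_continuous]) (auto simp: divide_le_eq)
    then obtain t where t: "0 \<le> t" "t \<le> 1/2" "I t = I (1/2) / 2 ^ j" by blast
    moreover have "t \<noteq> 0" using t(3) I0 half by auto
    ultimately show ?thesis using False by (intro exI[of _ t]) auto
  qed (auto intro: exI[of _ "1/2"])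
  then obtain T where T: "0 < T j \<and> T j \<le> 1/2 \<and> I (T j) = I (1/2) / 2 ^ j \<and> (j = 0 \<longrightarrow> T j = 1/2)"
    for j :: nat by metis
  have less: "s < t" if "I s < I t" "0 \<le> t" "s \<le> 1/2" for s t
    using that estimator_mono[of t s] by (meson not_le)
  have double: "I (T j) = 2 * I (T (Suc j))" for j using T[of j] T[of "Suc j"] by simp
  have desc: "T (Suc j) < T j" for j
  proof (rule less)
    have "0 < I (T (Suc j))" using T[of "Suc j"] by (intro estimator_pos) auto
    then show "I (T (Suc j)) < I (T j)" using double[of j] by simp
  qed (use T[of j] T[of "Suc j"] in auto)
  have null: "\<exists>j. T j < t" if t: "0 < t" "t < 1/2" for t
  proof -
    have "0 < I t" using t by (intro estimator_pos) auto
    then obtain j where "(1/2) ^ j < I t / I (1/2)"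
      using half real_arch_pow_inv[of "I t / I (1/2)" "1/2"] by auto
    then have "(1/2) ^ j * I (1/2) < I t" by (simp only: pos_less_divide_eq[OF half])
    moreover have "I (T j) = (1/2) ^ j * I (1/2)"
    proof -
      have "I (T j) = I (1/2) / 2 ^ j" using T by blast
      also have "\<dots> = (1/2) ^ j * I (1/2)" by (simp only: power_one_over times_divide_eq_left mult_1)
      finally show ?thesis .
    qed
    ultimately have "I (T j) < I t" by (simp only:)
    moreover have "0 \<le> t" "T j \<le> 1/2" using t T by simp_all
    ultimately have "T j < t" by (rule less)
    then show ?thesis by blast
  qed
  show thesis
  proof (rule that[of T])
    show "T 0 = 1/2" "\<And>j. 0 < T j" "\<And>j. T j \<le> 1/2" using T by simp_all
  qed (fact desc double null)+
qed

text \<open>For \<open>t\<close> in a block \<open>{T (Suc j)..T j}\<close>, the coarea inequality between the levels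
  \<open>u\<^sup>* (T j)\<close> and \<open>u\<^sup>* t\<close> has the constant lower bound \<open>I t\<close> for its integrand, because the superlevel
  sets at these heights have measure between \<open>t\<close> and \<open>T j\<close> and \<open>I\<close> increases up to \<open>1/2\<close>. The other
  ingredient is \<open>I s \<le> I (T j) = 2 * I (T (Suc j)) \<le> 2 * I t\<close> on \<open>{t..T j}\<close>, which allows the
  weight \<open>1 / I s\<close> to be brought under the integral of \<open>\<phi>\<close> at the cost of a factor two.\<close>

lemma decr_rearr_le_isoperimetric_hardy:
  assumes "prob_space M" and sets_M: "sets M = sets borel"
    and level: "\<And>f c. f \<in> Lip \<Longrightarrow> AE x in M. f x = c \<longrightarrow> grad_modulus f x = 0"
    and u: "u \<in> Lip" "\<And>x. 0 \<le> u x" "measure M {x. 0 < u x} \<le> 1/2"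
  obtains \<phi> A L where "\<phi> \<in> borel_measurable borel" "\<And>s. 0 \<le> \<phi> s" "\<And>s. \<phi> s \<le> L" "A \<in> sets M"
    "decr_rearr unit_interval \<phi> = decr_rearr M (\<lambda>x. grad_modulus u x * indicator A x)"
    "\<And>t. 0 < t \<Longrightarrow> t < 1/2 \<Longrightarrow> decr_rearr M u t \<le> 2 * isoperimetric_hardy I \<phi> t"
proof -
  interpret prob_space M by fact
  have space_M [simp]: "space M = UNIV" using sets_eq_imp_space_eq[OF sets_M] by simp
  note [measurable_cong] = sets_M
  have u_borel [measurable]: "u \<in> borel_measurable borel"
    using Lip_continuous[OF u(1)] by (rule borel_measurable_continuous_onI)
  have u_meas: "u \<in> borel_measurable M" by measurable
  have h_borel [measurable]: "grad_modulus u \<in> borel_measurable borel"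
    by (rule borel_measurable_grad_modulus[OF u(1)])
  have h_meas: "grad_modulus u \<in> borel_measurable M" by measurable
  obtain L where L: "L > 0" "\<And>x y. \<bar>u x - u y\<bar> \<le> L * dist x y" by (rule LipE[OF u(1)]) (rule that)
  obtain T where T_pos: "\<And>j. 0 < T j" and T_le: "\<And>j. T j \<le> 1/2" and T0: "T 0 = 1/2"
    and T_desc: "\<And>j. T (Suc j) < T j" and T_half: "\<And>j. I (T j) = 2 * I (T (Suc j))"
    and T_null: "\<And>t. 0 < t \<Longrightarrow> t < 1/2 \<Longrightarrow> \<exists>j. T j < t"
    by (rule estimator_halving_points) (rule that)
  have "decseq T" by (intro decseq_SucI less_imp_le T_desc)
  then have T_antimono: "T j \<le> T i" if "i \<le> j" for i j using that by (rule decseqD)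
  define r where "r = decr_rearr M u"
  have r_antimono: "r t \<le> r s" if "0 < s" "s \<le> t" for s t
    using that unfolding r_def by (intro decr_rearr_antimono u_meas)
  have r_nonneg: "0 \<le> r s" if "0 < s" for s
    using that unfolding r_def by (intro decr_rearr_nonneg u_meas)
  have between: "prob {x. r t' < u x \<and> u x < r t} \<le> t' - t" if "0 < t" "t \<le> t'" for t t'
    using prob_between_decr_rearr_le[OF u_meas u(2) that] by (simp add: r_def)
  define A where "A j = {x. r (T j) < u x \<and> u x < r (T (Suc j))}" for j
  have A_sets: "A j \<in> sets M" for j unfolding A_def by measurable
  have separated: "A i \<inter> A j = {} \<and> {T (Suc i)<..<T i} \<inter> {T (Suc j)<..<T j} = {}" if "i < j" for i j
  proof -
    have "T j \<le> T (Suc i)" using that by (intro T_antimono) auto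
    moreover from this have "r (T (Suc i)) \<le> r (T j)" by (intro r_antimono T_pos)
    ultimately show ?thesis by (auto simp: A_def)
  qed
  have disj: "disjoint_family A" "disjoint_family (\<lambda>j. {T (Suc j)<..<T j})"
  proof -
    have "A i \<inter> A j = {} \<and> {T (Suc i)<..<T i} \<inter> {T (Suc j)<..<T j} = {}" if "i \<noteq> j" for i j
    proof (cases "i < j")
      case False
      with that have "j < i" by simp
      from separated[OF this] show ?thesis
        by (simp only: Int_commute[of "A j"] Int_commute[of "{T (Suc j)<..<T j}"] simp_thms)
    qed (rule separated)
    then show "disjoint_family A" "disjoint_family (\<lambda>j. {T (Suc j)<..<T j})"
      unfolding disjoint_family_on_def by simp_all
  qed
  obtain \<phi> where \<phi>: "\<phi> \<in> borel_measurable borel" "\<And>s. 0 \<le> \<phi> s"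
    and \<phi>_le: "\<And>L s. \<forall>x\<in>space M. grad_modulus u x \<le> L \<Longrightarrow> 0 \<le> L \<Longrightarrow> \<phi> s \<le> L"
    and \<phi>_equi: "decr_rearr unit_interval \<phi>
      = decr_rearr M (\<lambda>x. grad_modulus u x * indicator (\<Union>j. A j) x)"
    and \<phi>_mass: "\<And>E t j. E \<in> sets M \<Longrightarrow> E \<subseteq> A j \<Longrightarrow> prob E \<le> T j - t \<Longrightarrow>
      (\<integral>\<^sup>+x\<in>E. ennreal (grad_modulus u x) \<partial>M) \<le> (\<integral>\<^sup>+s\<in>{t<..<T j}. ennreal (\<phi> s) \<partial>lborel)"
  proof (rule rearrange_onto_intervals[OF h_meas A_sets grad_modulus_nonneg disj])
    show "prob (A j) \<le> T j - T (Suc j)" for j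
      unfolding A_def using T_pos T_desc[of j] by (intro between) auto
    show "0 \<le> T (Suc j)" for j using T_pos[of "Suc j"] by simp
    show "T j \<le> 1" for j using T_le[of j] by simp
  qed (rule that)
  have \<phi>_bounded: "\<phi> s \<le> L" for s
  proof (rule \<phi>_le)
    show "\<forall>x\<in>space M. grad_modulus u x \<le> L" using L by (auto intro: grad_modulus_le)
  qed (use L(1) in simp)
  \<comment> \<open>The indicator makes \<open>k\<close> measurable on the whole line: outside \<open>{0..1}\<close> nothing is known about
    \<open>I\<close>.\<close>
  define k where "k s = \<phi> s / I s * indicator {0..1} s" for s
  have k_meas [measurable]: "k \<in> borel_measurable borel"
    unfolding k_def using \<phi>(1) by (rule divide_estimator_measurable)
  have block: "ennreal (r t - r (T j)) \<le> 2 * (\<integral>\<^sup>+s\<in>{t<..<T j}. ennreal (k s) \<partial>lborel)"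
    if t: "T (Suc j) \<le> t" "t \<le> T j" for t j
  proof -
    let ?E = "{x. r (T j) < u x \<and> u x < r t}"
    have t_pos: "0 < t" using T_pos[of "Suc j"] t(1) by linarith
    have t_half: "t \<le> 1/2" using T_le[of j] t(2) by linarith
    have It: "0 < I t" using t_pos t_half by (intro estimator_pos) auto
    have "ennreal (I t) * ennreal (r t - r (T j)) = ennreal (I t * (r t - r (T j)))"
      using It by (simp add: ennreal_mult')
    also have "\<dots> \<le> (\<integral>\<^sup>+x\<in>?E. ennreal (grad_modulus u x) \<partial>M)"
    proof (rule coarea_between_levels[OF assms(1) sets_M u(1) _ level])
      show "ereal (I (measure M B)) \<le> minkowski_content M B" if "B \<in> sets borel" for B
        using estimator that by (simp add: convex_isoperimetric_estimator_def)
      show "0 \<le> I t" using It by simp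
      fix s assume s: "r (T j) \<le> s" "s < r t"
      have s_nonneg: "0 \<le> s" using s(1) r_nonneg[OF T_pos[of j]] by simp
      have "t \<le> prob {x. s < u x}"
        using less_decr_rearr_iff[OF u_meas t_pos s_nonneg] s(2) u(2) by (simp add: r_def)
      moreover have "prob {x. s < u x} \<le> T j"
        using decr_rearr_le_iff[OF u_meas T_pos[of j] s_nonneg] s(1) u(2) by (simp add: r_def)
      ultimately show "I t \<le> I (prob {x. s < u x})"
        using t_pos T_le[of j] by (intro estimator_mono) auto
    qed
    also have "\<dots> \<le> (\<integral>\<^sup>+s\<in>{t<..<T j}. ennreal (\<phi> s) \<partial>lborel)"
    proof (rule \<phi>_mass)
      show "?E \<subseteq> A j" using r_antimono[OF T_pos t(1)] by (auto simp: A_def)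
      show "prob ?E \<le> T j - t" using t_pos t(2) by (rule between)
    qed measurable
    also have "\<dots> \<le> (\<integral>\<^sup>+s. ennreal (2 * I t) * (ennreal (k s) * indicator {t<..<T j} s) \<partial>lborel)"
    proof (rule nn_integral_mono)
      fix s
      show "ennreal (\<phi> s) * indicator {t<..<T j} s
          \<le> ennreal (2 * I t) * (ennreal (k s) * indicator {t<..<T j} s)"
      proof (cases "s \<in> {t<..<T j}")
        case True
        have s: "0 < s" "s \<le> 1/2" using True t_pos T_le[of j] by auto
        have "I s \<le> I (T j)" using True s T_le[of j] by (intro estimator_mono) auto
        also have "\<dots> \<le> 2 * I t"
          unfolding T_half[of j] using t(1) T_pos[of "Suc j"] t_half
          by (intro mult_left_mono estimator_mono) auto
        finally have "I s \<le> 2 * I t" .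
        moreover have "0 < I s" using s by (intro estimator_pos) auto
        ultimately have "\<phi> s \<le> 2 * I t * (\<phi> s / I s)"
          using mult_right_mono[of "I s" "2 * I t" "\<phi> s"] \<phi>(2)[of s] by (simp add: le_divide_eq ac_simps)
        then have "\<phi> s \<le> 2 * I t * k s" using s by (simp add: k_def)
        then show ?thesis using True It by (simp add: ennreal_mult'[symmetric] ennreal_leI)
      qed simp
    qed
    also have "\<dots> = ennreal (2 * I t) * (\<integral>\<^sup>+s\<in>{t<..<T j}. ennreal (k s) \<partial>lborel)"
      by (intro nn_integral_cmult) measurable
    also have "\<dots> = ennreal (I t) * (2 * (\<integral>\<^sup>+s\<in>{t<..<T j}. ennreal (k s) \<partial>lborel))"
      using It by (simp add: ennreal_mult' ac_simps)
    finally show ?thesis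
      using It by (subst (asm) ennreal_mult_le_mult_iff) auto
  qed
  \<comment> \<open>Summation over the blocks; at \<open>T 0 = 1/2\<close> the rearrangement vanishes since \<open>u\<close> lives on a
    set of measure at most one half.\<close>
  have "\<forall>t. T j \<le> t \<longrightarrow> t \<le> 1/2 \<longrightarrow> ennreal (r t) \<le> 2 * (\<integral>\<^sup>+s\<in>{t..1/2}. ennreal (k s) \<partial>lborel)" for j
  proof (induction j)
    case 0
    have "r (1/2) \<le> 0"
      unfolding r_def using u(2,3) by (subst decr_rearr_le_iff[OF u_meas]) auto
    show ?case
    proof (intro allI impI)
      fix t assume "T 0 \<le> t" "t \<le> 1/2"
      then have "t = 1/2" using T0 by simp
      then have "r t \<le> 0" using \<open>r (1/2) \<le> 0\<close> by (simp only:)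
      then have "ennreal (r t) = 0" by (rule ennreal_neg)
      then show "ennreal (r t) \<le> 2 * (\<integral>\<^sup>+s\<in>{t..1/2}. ennreal (k s) \<partial>lborel)" by simp
    qed
  next
    case (Suc j)
    show ?case
    proof (intro allI impI)
      fix t assume t: "T (Suc j) \<le> t" "t \<le> 1/2"
      show "ennreal (r t) \<le> 2 * (\<integral>\<^sup>+s\<in>{t..1/2}. ennreal (k s) \<partial>lborel)"
      proof (cases "T j \<le> t")
        case False
        have "r (T j) \<le> r t" using False t T_pos[of "Suc j"] by (intro r_antimono) auto
        then have "ennreal (r t) = ennreal (r t - r (T j)) + ennreal (r (T j))"
          using r_nonneg[OF T_pos[of j]] by (subst ennreal_plus[symmetric]) auto
        also have "\<dots> \<le> 2 * (\<integral>\<^sup>+s\<in>{t<..<T j}. ennreal (k s) \<partial>lborel)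
            + 2 * (\<integral>\<^sup>+s\<in>{T j..1/2}. ennreal (k s) \<partial>lborel)"
          using Suc.IH t False T_le[of j] by (intro add_mono block) auto
        also have "\<dots> = 2 * ((\<integral>\<^sup>+s\<in>{t<..<T j}. ennreal (k s) \<partial>lborel)
            + (\<integral>\<^sup>+s\<in>{T j..1/2}. ennreal (k s) \<partial>lborel))"
          by (simp add: distrib_left)
        also have "\<dots> = 2 * (\<integral>\<^sup>+s. ennreal (k s) * indicator {t<..<T j} s
            + ennreal (k s) * indicator {T j..1/2} s \<partial>lborel)"
          by (subst nn_integral_add) auto
        also have "\<dots> \<le> 2 * (\<integral>\<^sup>+s\<in>{t..1/2}. ennreal (k s) \<partial>lborel)"
          using False T_le[of j]
          by (intro mult_left_mono nn_integral_mono) (auto simp: indicator_def)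
        finally show ?thesis .
      qed (use Suc t in auto)
    qed
  qed
  note bound = this
  have "decr_rearr M u t \<le> 2 * isoperimetric_hardy I \<phi> t" if t: "0 < t" "t < 1/2" for t
  proof -
    note Q = isoperimetric_hardy_eq_nn_integral[OF \<phi> \<phi>_bounded t]
    obtain j where "T j < t" using T_null[OF t] by blast
    then have "ennreal (r t) \<le> 2 * (\<integral>\<^sup>+s\<in>{t..1/2}. ennreal (k s) \<partial>lborel)"
      using bound[of j] t by auto
    also have "(\<integral>\<^sup>+s\<in>{t..1/2}. ennreal (k s) \<partial>lborel) = ennreal (isoperimetric_hardy I \<phi> t)"
      unfolding Q(1) using t by (intro nn_integral_cong) (auto simp: k_def indicator_def)
    also have "2 * \<dots> = ennreal (2 * isoperimetric_hardy I \<phi> t)"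
      by (simp add: ennreal_mult')
    finally show ?thesis using Q(2) by (simp add: r_def ennreal_le_iff)
  qed
  then show thesis using that[of \<phi> L "\<Union>j. A j"] \<phi> \<phi>_bounded \<phi>_equi A_sets by blast
qed

end

section \<open>Transfer of the norm inequality\<close>

context
  fixes M :: "'a measure" and N :: "('a \<Rightarrow> real) \<Rightarrow> ennreal" and K :: real
  assumes N: "function_quasinorm M K N"
begin

lemma quasinorm_mono_AE:
  "f \<in> borel_measurable M \<Longrightarrow> g \<in> borel_measurable M \<Longrightarrow> AE x in M. \<bar>f x\<bar> \<le> \<bar>g x\<bar> \<Longrightarrow> N f \<le> N g"
  using N by (simp add: function_quasinorm_def)

lemma quasinorm_scale: "f \<in> borel_measurable M \<Longrightarrow> N (\<lambda>x. a * f x) = ennreal \<bar>a\<bar> * N f"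
  using N by (simp add: function_quasinorm_def)

lemma quasinorm_add:
  "f \<in> borel_measurable M \<Longrightarrow> g \<in> borel_measurable M \<Longrightarrow>
    N (\<lambda>x. f x + g x) \<le> ennreal K * (N f + N g)"
  using N by (simp add: function_quasinorm_def)

lemma quasinorm_bounded_finite:
  assumes "finite_measure M" "f \<in> borel_measurable M" "\<And>x. \<bar>f x\<bar> \<le> L"
  shows "N f < \<infinity>"
proof -
  interpret finite_measure M by fact
  let ?one = "indicator (space M) :: 'a \<Rightarrow> real"
  have "\<forall>E\<in>sets M. emeasure M E < \<infinity> \<longrightarrow> N (indicator E) < \<infinity>"
    using N unfolding function_quasinorm_def by (elim conjE)
  moreover have "emeasure M (space M) < \<infinity>" by (simp add: less_top[symmetric])
  ultimately have one_finite: "N ?one < top" by simp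
  have "AE x in M. \<bar>f x\<bar> \<le> \<bar>L * ?one x\<bar>"
    using assms(3) by (intro AE_I2) (auto intro: order_trans[OF _ abs_ge_self])
  then have "N f \<le> N (\<lambda>x. L * ?one x)"
    using assms(2) by (intro quasinorm_mono_AE) auto
  also have "\<dots> = ennreal \<bar>L\<bar> * N ?one" by (intro quasinorm_scale) auto
  also have "\<dots> < \<infinity>"
    by (simp add: ennreal_mult_less_top one_finite)
  finally show ?thesis .
qed

end

lemma rearr_invariantD:
  assumes "rearr_invariant M N" "f \<in> borel_measurable M" "N f < \<infinity>" "g \<in> borel_measurable M"
    and "decr_rearr M g = decr_rearr M f"
  shows "N g = N f"
proof -
  have "f \<in> in_space M N" using assms(2,3) by (simp add: in_space_def)
  moreover have "\<forall>s\<in>{0<..<1}. decr_rearr M g s = decr_rearr M f s" using assms(5) by (intro ballI) (simp only:)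
  ultimately show ?thesis using assms(1,4) unfolding rearr_invariant_def by blast
qed

text \<open>With \<open>\<phi>\<close> dominating \<open>u\<^sup>*\<close> through the Hardy operator, rearrangement invariance gives
  \<open>Xbar \<phi> = X (|\<nabla>u| * indicator A)\<close>, which is at most \<open>X |\<nabla>u|\<close> by monotonicity.\<close>

lemma quasinorm_half_bound:
  fixes M :: "'a::metric_space measure"
  assumes M: "prob_space M" "sets M = sets borel"
    and level: "\<And>f c. f \<in> Lip \<Longrightarrow> AE x in M. f x = c \<longrightarrow> grad_modulus f x = 0"
    and estimator: "convex_isoperimetric_estimator M I"
    and Y: "function_quasinorm unit_interval K Y"
    and X: "ri_space M X" and Xbar: "representation_space M X Xbar"
    and hardy: "\<And>f. f \<in> in_space unit_interval Xbar \<Longrightarrow>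
           Y (isoperimetric_hardy I f) \<le> ennreal C * Xbar f"
    and u: "u \<in> Lip" "\<And>x. 0 \<le> u x" "measure M {x. 0 < u x} \<le> 1/2"
  shows "Y (decr_rearr M u) \<le> 2 * (ennreal C * X (grad_modulus u))"
proof -
  interpret prob_space M by fact
  note [measurable_cong] = M(2)
  have X_norm: "function_quasinorm M 1 X"
    using X by (simp add: ri_space_def banach_function_space_def)
  have Xbar_ri: "rearr_invariant unit_interval Xbar"
    using Xbar by (simp add: representation_space_def ri_space_def)
  have [measurable]: "u \<in> borel_measurable borel"
    using Lip_continuous[OF u(1)] by (rule borel_measurable_continuous_onI)
  have u_meas: "u \<in> borel_measurable M" by measurable
  have [measurable]: "grad_modulus u \<in> borel_measurable borel"
    by (rule borel_measurable_grad_modulus[OF u(1)])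
  have h_meas: "grad_modulus u \<in> borel_measurable M" by measurable
  obtain \<phi> A L where \<phi>: "\<phi> \<in> borel_measurable borel" "\<And>s. 0 \<le> \<phi> s" "\<And>s. \<phi> s \<le> L"
    and A: "A \<in> sets M"
    and equi: "decr_rearr unit_interval \<phi> = decr_rearr M (\<lambda>x. grad_modulus u x * indicator A x)"
    and le: "\<And>t. 0 < t \<Longrightarrow> t < 1/2 \<Longrightarrow> decr_rearr M u t \<le> 2 * isoperimetric_hardy I \<phi> t"
    by (rule decr_rearr_le_isoperimetric_hardy[OF estimator M level u]) (assumption, rule that)
  define f where "f x = grad_modulus u x * indicator A x" for x
  have f_meas: "f \<in> borel_measurable M" unfolding f_def using h_meas A by measurable
  have f_le: "X f \<le> X (grad_modulus u)"
  proof (rule quasinorm_mono_AE[OF X_norm f_meas h_meas])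
    show "AE x in M. \<bar>f x\<bar> \<le> \<bar>grad_modulus u x\<bar>"
      by (intro AE_I2) (auto simp: f_def indicator_def)
  qed
  have f_finite: "X f < \<infinity>"
  proof -
    obtain L' where L': "L' > 0" "\<And>x y. \<bar>u x - u y\<bar> \<le> L' * dist x y"
      by (rule LipE[OF u(1)]) (rule that)
    have "\<bar>grad_modulus u x\<bar> \<le> L'" for x
      using grad_modulus_le[of u x L'] L' grad_modulus_nonneg[of u x] by simp
    then have "X (grad_modulus u) < \<infinity>"
      by (rule quasinorm_bounded_finite[OF X_norm finite_measure_axioms h_meas])
    with f_le show ?thesis by (rule le_less_trans)
  qed
  then have Xf: "X f = Xbar (decr_rearr M f)"
    using Xbar f_meas by (simp add: representation_space_def in_space_def)
  have \<phi>_meas: "\<phi> \<in> borel_measurable unit_interval"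
    using \<phi>(1) by (intro measurable_restrict_space1 measurable_completion) simp
  have Xbar_\<phi>: "Xbar \<phi> = X f"
    unfolding Xf
  proof (rule rearr_invariantD[OF Xbar_ri])
    show "Xbar (decr_rearr M f) < \<infinity>" using f_finite Xf by simp
    show "decr_rearr unit_interval \<phi> = decr_rearr unit_interval (decr_rearr M f)"
      unfolding decr_rearr_decr_rearr[OF f_meas] equi f_def ..
  qed (intro decr_rearr_measurable f_meas \<phi>_meas)+
  note Q_meas = isoperimetric_hardy_measurable[OF estimator \<phi>]
  have "Y (decr_rearr M u) \<le> Y (\<lambda>t. 2 * isoperimetric_hardy I \<phi> t)"
  proof (rule quasinorm_mono_AE[OF Y])
    have "\<bar>decr_rearr M u t\<bar> \<le> \<bar>2 * isoperimetric_hardy I \<phi> t\<bar>" if t: "0 < t" "t < 1" for t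
    proof (cases "t < 1/2")
      case True
      then show ?thesis using le[OF t(1)] decr_rearr_nonneg[OF u_meas t(1)] by simp
    next
      case False
      have "decr_rearr M u t \<le> 0"
      proof (subst decr_rearr_le_iff[OF u_meas t(1)])
        have "{x \<in> space M. 0 < \<bar>u x\<bar>} = {x. 0 < u x}"
          using u(2) sets_eq_imp_space_eq[OF M(2)] by auto
        then show "prob {x \<in> space M. 0 < \<bar>u x\<bar>} \<le> t" using u(3) False by simp
      qed simp
      then show ?thesis using decr_rearr_nonneg[OF u_meas t(1)] by simp
    qed
    then show "AE t in unit_interval. \<bar>decr_rearr M u t\<bar> \<le> \<bar>2 * isoperimetric_hardy I \<phi> t\<bar>"
      by (intro AE_I2) (simp add: space_restrict_space)
  qed (use decr_rearr_measurable[OF u_meas] Q_meas in simp_all)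
  also have "\<dots> = 2 * Y (isoperimetric_hardy I \<phi>)"
    using quasinorm_scale[OF Y Q_meas, of 2] by simp
  also have "\<dots> \<le> 2 * (ennreal C * X (grad_modulus u))"
  proof (rule mult_left_mono)
    have "Y (isoperimetric_hardy I \<phi>) \<le> ennreal C * Xbar \<phi>"
      using \<phi>_meas f_finite Xbar_\<phi> by (intro hardy) (simp add: in_space_def)
    also have "\<dots> \<le> ennreal C * X (grad_modulus u)"
      unfolding Xbar_\<phi> using f_le by (rule mult_left_mono) simp
    finally show "Y (isoperimetric_hardy I \<phi>) \<le> ennreal C * X (grad_modulus u)" .
  qed simp
  finally show ?thesis .
qed

text \<open>If \<open>u\<close> and \<open>v\<close> have disjoint supports, each of measure at most one half, then
  \<open>|u| + |v|\<close> has the same distribution as \<open>u\<^sup>*\<close> placed on the left half of the interval plus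
  \<open>v\<^sup>*\<close> reflected onto the right half.\<close>

lemma (in prob_space) quasinorm_decr_rearr_disjoint_le:
  fixes u v w :: "'a \<Rightarrow> real"
  assumes Y: "function_quasinorm unit_interval K Y" "rearr_invariant unit_interval Y"
    and [measurable]: "u \<in> borel_measurable M" "v \<in> borel_measurable M" "w \<in> borel_measurable M"
    and half: "prob {x \<in> space M. 0 < \<bar>u x\<bar>} \<le> 1/2" "prob {x \<in> space M. 0 < \<bar>v x\<bar>} \<le> 1/2"
    and disj: "\<And>x. x \<in> space M \<Longrightarrow> u x = 0 \<or> v x = 0"
    and w: "\<And>x. x \<in> space M \<Longrightarrow> \<bar>w x\<bar> = \<bar>u x\<bar> + \<bar>v x\<bar>"
    and finite: "Y (decr_rearr M u) < \<infinity>" "Y (decr_rearr M v) < \<infinity>"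
  shows "Y (decr_rearr M w) \<le> ennreal K * (Y (decr_rearr M u) + Y (decr_rearr M v))"
proof -
  define r where "r = decr_rearr M u"
  define r' where "r' s = decr_rearr M v (1 - s)" for s
  define D where "D f l = prob {x \<in> space M. l < \<bar>f x\<bar>}" for f :: "'a \<Rightarrow> real" and l
  have D_nonneg: "0 \<le> D f l" for f l by (simp add: D_def)
  have D_le: "D u l \<le> 1/2" "D v l \<le> 1/2" if "0 \<le> l" for l
  proof -
    have "D f l \<le> D f 0" if [measurable]: "f \<in> borel_measurable M" for f
      unfolding D_def using \<open>0 \<le> l\<close> by (intro finite_measure_mono) auto
    from this[of u] this[of v] show "D u l \<le> 1/2" "D v l \<le> 1/2" using half by (simp_all add: D_def)
  qed
  have D_w: "D w l = D u l + D v l" if l: "0 \<le> l" for l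
  proof -
    have "{x \<in> space M. l < \<bar>w x\<bar>} = {x \<in> space M. l < \<bar>u x\<bar>} \<union> {x \<in> space M. l < \<bar>v x\<bar>}"
    proof (intro set_eqI)
      fix x
      show "x \<in> {x \<in> space M. l < \<bar>w x\<bar>}
          \<longleftrightarrow> x \<in> {x \<in> space M. l < \<bar>u x\<bar>} \<union> {x \<in> space M. l < \<bar>v x\<bar>}"
        using disj[of x] w[of x] l by (cases "x \<in> space M") auto
    qed
    moreover have "{x \<in> space M. l < \<bar>u x\<bar>} \<inter> {x \<in> space M. l < \<bar>v x\<bar>} = {}"
    proof (intro equals0I)
      fix x assume "x \<in> {x \<in> space M. l < \<bar>u x\<bar>} \<inter> {x \<in> space M. l < \<bar>v x\<bar>}"
      then show False using disj[of x] l by auto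
    qed
    ultimately show ?thesis unfolding D_def by (simp add: finite_measure_Union)
  qed
  have r_meas: "r \<in> borel_measurable unit_interval"
    unfolding r_def by (rule decr_rearr_measurable) measurable
  have r'_meas: "r' \<in> borel_measurable unit_interval"
  proof (rule mono_on_measurable_unit_interval, rule mono_onI)
    fix s t :: real assume "s \<in> {0<..<1}" "t \<in> {0<..<1}" "s \<le> t"
    then show "r' s \<le> r' t" unfolding r'_def by (intro decr_rearr_antimono) auto
  qed
  have r_nonneg: "0 \<le> r s" and r_iff: "0 \<le> l \<Longrightarrow> l < r s \<longleftrightarrow> s < D u l" if "0 < s" for s l
    using that unfolding r_def D_def by (auto intro: decr_rearr_nonneg simp: less_decr_rearr_iff)
  have r'_nonneg: "0 \<le> r' s" and r'_iff: "0 \<le> l \<Longrightarrow> l < r' s \<longleftrightarrow> 1 - D v l < s" if "s < 1" for s l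
    using that unfolding r'_def D_def by (auto intro: decr_rearr_nonneg simp: less_decr_rearr_iff)
  have r_zero: "r s = 0" if "1/2 \<le> s" for s
    using r_nonneg[of s] r_iff[of s 0] D_le(1)[of 0] that by fastforce
  have r'_zero: "r' s = 0" if "s \<le> 1/2" for s
    using r'_nonneg[of s] r'_iff[of s 0] D_le(2)[of 0] that by fastforce
  have r'_equi: "decr_rearr unit_interval r' = decr_rearr M v"
  proof (rule decr_rearr_cong)
    fix l :: real assume l: "0 \<le> l"
    have "{s \<in> space unit_interval. l < \<bar>r' s\<bar>} = {1 - D v l<..<1}"
    proof (intro set_eqI)
      fix s
      show "s \<in> {s \<in> space unit_interval. l < \<bar>r' s\<bar>} \<longleftrightarrow> s \<in> {1 - D v l<..<1}"
        using r'_nonneg[of s] r'_iff[of s l] D_le(2)[OF l] l by (auto simp: space_restrict_space)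
    qed
    moreover have "measure unit_interval {1 - D v l<..<1} = D v l"
      using D_le(2)[OF l] D_nonneg[of v l] by (subst measure_unit_interval) auto
    ultimately show "measure unit_interval {s \<in> space unit_interval. l < \<bar>r' s\<bar>}
        = prob {x \<in> space M. l < \<bar>v x\<bar>}"
      by (simp only: D_def)
  qed
  have sum_equi: "decr_rearr unit_interval (\<lambda>s. r s + r' s) = decr_rearr M w"
  proof (rule decr_rearr_cong)
    fix l :: real assume l: "0 \<le> l"
    have "{s \<in> space unit_interval. l < \<bar>r s + r' s\<bar>} = {0<..<D u l} \<union> {1 - D v l<..<1}"
    proof (intro set_eqI)
      fix s
      show "s \<in> {s \<in> space unit_interval. l < \<bar>r s + r' s\<bar>} \<longleftrightarrow> s \<in> {0<..<D u l} \<union> {1 - D v l<..<1}"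
      proof (cases "s \<in> {0<..<1}")
        case True
        then show ?thesis
          using r_iff[of s l] r'_iff[of s l] r_nonneg[of s] r'_nonneg[of s] r_zero[of s] r'_zero[of s] l
            D_le[OF l]
          by (cases "s \<le> 1/2") (auto simp: space_restrict_space)
      next
        case False
        then show ?thesis using D_le[OF l] D_nonneg[of u l] by (auto simp: space_restrict_space)
      qed
    qed
    moreover have "measure unit_interval ({0<..<D u l} \<union> {1 - D v l<..<1}) = D u l + D v l"
    proof -
      have "measure unit_interval ({0<..<D u l} \<union> {1 - D v l<..<1})
          = measure lborel ({0<..<D u l} \<union> {1 - D v l<..<1})"
        using D_le[OF l] by (intro measure_unit_interval) auto
      also have "\<dots> = measure lborel {0<..<D u l} + measure lborel {1 - D v l<..<1}"
        using D_le[OF l] D_nonneg by (intro measure_Union) auto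
      also have "\<dots> = D u l + D v l" using D_nonneg by simp
      finally show ?thesis .
    qed
    ultimately show "measure unit_interval {s \<in> space unit_interval. l < \<bar>r s + r' s\<bar>}
        = prob {x \<in> space M. l < \<bar>w x\<bar>}"
      using D_w[OF l] by (simp only: D_def)
  qed
  have v_equi: "decr_rearr unit_interval (decr_rearr M v) = decr_rearr M v"
    and w_equi: "decr_rearr unit_interval (decr_rearr M w) = decr_rearr M w"
    by (intro decr_rearr_decr_rearr; measurable)+
  have Y_r': "Y r' = Y (decr_rearr M v)"
    by (rule rearr_invariantD[OF Y(2) decr_rearr_measurable finite(2) r'_meas])
      (simp_all add: r'_equi v_equi)
  have sum_le: "Y (\<lambda>s. r s + r' s) \<le> ennreal K * (Y (decr_rearr M u) + Y (decr_rearr M v))"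
    using quasinorm_add[OF Y(1) r_meas r'_meas] unfolding Y_r' by (simp add: r_def)
  also have "\<dots> < \<infinity>" using finite by (simp add: ennreal_mult_less_top)
  finally have "Y (decr_rearr M w) = Y (\<lambda>s. r s + r' s)"
    by (intro rearr_invariantD[OF Y(2)] borel_measurable_add r_meas r'_meas decr_rearr_measurable)
      (simp_all add: sum_equi w_equi)
  with sum_le show ?thesis by simp
qed

theorem theorem10:
  fixes M :: "'a::metric_space measure"
    and I :: "real \<Rightarrow> real"
    and Y Xbar :: "(real \<Rightarrow> real) \<Rightarrow> ennreal"
    and X :: "('a \<Rightarrow> real) \<Rightarrow> ennreal"
    and C :: real
  assumes "connected (UNIV :: 'a set)"
    and "prob_space M" and "sets M = sets borel"
    and "separable_measure M" and "non_atomic M"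
    and "\<And>f c. f \<in> Lip \<Longrightarrow> AE x in M. f x = c \<longrightarrow> grad_modulus f x = 0"
    and "convex_isoperimetric_estimator M I"
    and "qri_space unit_interval Y"
    and "ri_space M X"
    and "representation_space M X Xbar"
    and "C > 0"
    and "\<And>f. f \<in> in_space unit_interval Xbar \<Longrightarrow>
           Y (isoperimetric_hardy I f) \<le> ennreal C * Xbar f"
  shows "\<exists>C'>0. \<forall>g\<in>Lip.
           (INF c. Y (decr_rearr M (\<lambda>x. g x - c))) \<le> ennreal C' * X (grad_modulus g)"
proof -
  interpret prob_space M by fact
  have space_M [simp]: "space M = UNIV" using sets_eq_imp_space_eq[OF assms(3)] by simp
  note [measurable_cong] = assms(3)
  obtain K where K: "1 \<le> K" and Y: "function_quasinorm unit_interval K Y"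
    using assms(8) by (auto simp: qri_space_def quasi_banach_function_space_def)
  have Y_ri: "rearr_invariant unit_interval Y" using assms(8) by (simp add: qri_space_def)
  have X: "function_quasinorm M 1 X"
    using assms(9) by (simp add: ri_space_def banach_function_space_def)
  have "(INF c. Y (decr_rearr M (\<lambda>x. g x - c))) \<le> ennreal (4 * K * C) * X (grad_modulus g)"
    if g: "g \<in> Lip" for g
  proof -
    have [measurable]: "g \<in> borel_measurable borel"
      using Lip_continuous[OF g] by (rule borel_measurable_continuous_onI)
    have g_meas: "g \<in> borel_measurable M" by measurable
    obtain m where m: "prob {x. m < g x} \<le> 1/2" "prob {x. g x < m} \<le> 1/2"
      using median_exists[OF g_meas] by auto
    have grad_meas: "grad_modulus f \<in> borel_measurable M" if "f \<in> Lip" for f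
      using borel_measurable_grad_modulus[OF that] by measurable
    have grad_finite: "X (grad_modulus g) < \<infinity>"
    proof -
      obtain L where L: "L > 0" "\<And>x y. \<bar>g x - g y\<bar> \<le> L * dist x y"
        by (rule LipE[OF g]) (rule that)
      have "\<bar>grad_modulus g x\<bar> \<le> L" for x
        using grad_modulus_le[of g x L] L grad_modulus_nonneg[of g x] by simp
      then show ?thesis
        by (rule quasinorm_bounded_finite[OF X finite_measure_axioms grad_meas[OF g]])
    qed
    have part: "Y (decr_rearr M u) \<le> 2 * (ennreal C * X (grad_modulus g))"
      if contr: "\<And>x y. \<bar>u x - u y\<bar> \<le> \<bar>g x - g y\<bar>"
        and u: "\<And>x. 0 \<le> u x" "prob {x. 0 < u x} \<le> 1/2" for u
    proof -
      have u_Lip: "u \<in> Lip" using g contr by (rule Lip_contraction)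
      have "X (grad_modulus u) \<le> X (grad_modulus g)"
      proof (rule quasinorm_mono_AE[OF X grad_meas[OF u_Lip] grad_meas[OF g]])
        have "\<bar>grad_modulus u x\<bar> \<le> \<bar>grad_modulus g x\<bar>" for x
          using grad_modulus_contraction[OF g contr, of x] grad_modulus_nonneg[of u x] by simp
        then show "AE x in M. \<bar>grad_modulus u x\<bar> \<le> \<bar>grad_modulus g x\<bar>" by simp
      qed
      then have "2 * (ennreal C * X (grad_modulus u)) \<le> 2 * (ennreal C * X (grad_modulus g))"
        by (intro mult_left_mono) auto
      moreover have "Y (decr_rearr M u) \<le> 2 * (ennreal C * X (grad_modulus u))"
        by (rule quasinorm_half_bound[OF assms(2,3,6,7) Y assms(9,10,12) u_Lip u])
      ultimately show ?thesis by (rule order_trans[rotated])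
    qed
    define u where "u x = max (g x - m) 0" for x
    define v where "v x = max (m - g x) 0" for x
    have pos: "0 < u x \<longleftrightarrow> m < g x" "0 < v x \<longleftrightarrow> g x < m" for x by (auto simp: u_def v_def)
    have abs_uv: "\<bar>u x\<bar> = u x" "\<bar>v x\<bar> = v x" for x by (auto simp: u_def v_def)
    have u_le: "Y (decr_rearr M u) \<le> 2 * (ennreal C * X (grad_modulus g))"
    proof (rule part)
      show "prob {x. 0 < u x} \<le> 1/2" unfolding pos by (rule m(1))
    qed (auto simp: u_def)
    have v_le: "Y (decr_rearr M v) \<le> 2 * (ennreal C * X (grad_modulus g))"
    proof (rule part)
      show "prob {x. 0 < v x} \<le> 1/2" unfolding pos by (rule m(2))
    qed (auto simp: v_def)
    have finite: "2 * (ennreal C * X (grad_modulus g)) < \<infinity>"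
      using grad_finite by (simp add: ennreal_mult_less_top)
    have "(INF c. Y (decr_rearr M (\<lambda>x. g x - c))) \<le> Y (decr_rearr M (\<lambda>x. g x - m))"
      by (rule INF_lower) simp
    also have "\<dots> \<le> ennreal K * (Y (decr_rearr M u) + Y (decr_rearr M v))"
    proof (rule quasinorm_decr_rearr_disjoint_le[OF Y Y_ri])
      show "u \<in> borel_measurable M" unfolding u_def by measurable
      show "v \<in> borel_measurable M" unfolding v_def by measurable
      show "prob {x \<in> space M. 0 < \<bar>u x\<bar>} \<le> 1/2" "prob {x \<in> space M. 0 < \<bar>v x\<bar>} \<le> 1/2"
        unfolding abs_uv pos using m by simp_all
      show "Y (decr_rearr M u) < \<infinity>" using u_le finite by (rule le_less_trans)
      show "Y (decr_rearr M v) < \<infinity>" using v_le finite by (rule le_less_trans)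
    qed (auto simp: u_def v_def)
    also have "\<dots> \<le> ennreal K * (2 * (ennreal C * X (grad_modulus g)) + 2 * (ennreal C * X (grad_modulus g)))"
      using u_le v_le by (intro mult_left_mono add_mono) auto
    also have "\<dots> = ennreal (4 * K * C) * X (grad_modulus g)"
    proof -
      have "ennreal (4 * K * C) = 4 * ennreal K * ennreal C"
        using K assms(11) by (simp add: ennreal_mult)
      then show ?thesis by (simp add: mult_2[symmetric] ac_simps)
    qed
    finally show ?thesis .
  qed
  moreover have "0 < 4 * K * C" using K assms(11) by simp
  ultimately show ?thesis by blast
qed

end
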